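(* Two finite-dimensional complex solvable Lie algebras $\mathfrak{s}$ and $\mathfrak{s}'$ are spectrally equivalent if and only if $e_0(\mathfrak{s})=e_0(\mathfrak{s}')$ and the multisets of nonzero nilradical weights $\Delta_{\mathfrak s}^{\times}$ and $\Delta_{\mathfrak s'}^{\times}$ are linearly equivalent, with multiplicities preserved.
   Context: Characteristic polynomial: for a Lie algebra $L$ with basis $x_1,\dots,x_n$, $Q_L(z_0,\mathbf{z})=\det(z_0I+\sum_{i=1}^n z_i\operatorname{ad}x_i)$, $\mathbf{z}=(z_1,\dots,z_n)$. Two Lie algebras $L_1,L_2$ of the same dimension $n$ over $\mathbb{C}$ are spectrally equivalent, $L_1\sim L_2$, if $Q_{L_2}(z_0,\mathbf{z})=Q_{L_1}(z_0,\mathbf{z}B)$ for some $B\in\operatorname{GL}_n(\mathbb{C})$ (this does not depend on the bases chosen); Lie algebras of different dimensions are not spectrally equivalent. $e_0(\mathfrak{s})$ is the multiplicity of the factor $z_0$ in $Q_{\mathfrak{s}}$. Nilradical weights: let $\mathfrak{n}$ be the nilradical (unique maximal nilpotent ideal) of $\mathfrak{s}$, $\mathfrak{v}$ a vector-space complement, $M=\dim\mathfrak{n}$. By Lie's theorem there is a basis of $\mathfrak{n}$ in which all $\operatorname{ad}(y)|_{\mathfrak{n}}$, $y\in\mathfrak{s}$, are upper triangular, with diagonal entries linear functionals $\lambda_1,\dots,\lambda_M\in\mathfrak{s}^*$ that vanish on $\mathfrak{n}$. The nilradical weight multiset is $\{\lambda_1|_{\mathfrak{v}},\dots,\lambda_M|_{\mathfrak{v}}\}\subset\mathfrak{v}^*$,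 counted with multiplicity; $\Delta_{\mathfrak{s}}^{\times}$ is the sub-multiset of its nonzero elements. Two multisets of vectors $E$, $E'$ are linearly equivalent if there is a linear isomorphism $T:\operatorname{span}E\to\operatorname{span}E'$ with $T(E)=E'$ as multisets (multiplicities preserved). *)

theory Defs
  imports
    "Jordan_Normal_Form.Determinant"
    "HOL-Library.Poly_Mapping"
    "HOL-Library.Function_Algebras"
    "HOL-Library.Multiset"
begin

section \<open>Polynomials over the complex numbers\<close>

text \<open>
  Polynomials in variables indexed by the natural numbers, as the monoid algebra of
  finitely supported exponent vectors. Variable \<open>0\<close> plays the role of $z_0$, and
  variable \<open>Suc i\<close> that of $z_{i+1}$, the variable belonging to the list entry \<open>xs ! i\<close>.
\<close>

type_synonym cpoly = "(nat \<Rightarrow>\<^sub>0 nat) \<Rightarrow>\<^sub>0 complex"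

definition Var :: "nat \<Rightarrow> cpoly" where
  "Var i = Poly_Mapping.single (Poly_Mapping.single i 1) 1"

definition Const :: "complex \<Rightarrow> cpoly" where
  "Const c = Poly_Mapping.single 0 c"

definition subst :: "(nat \<Rightarrow> cpoly) \<Rightarrow> cpoly \<Rightarrow> cpoly" where
  "subst f p = (\<Sum>m\<in>Poly_Mapping.keys p.
      Const (Poly_Mapping.lookup p m) *
      (\<Prod>i\<in>Poly_Mapping.keys m. f i ^ Poly_Mapping.lookup m i))"

text \<open>
  The substitution $(z_0, \mathbf z) \mapsto (z_0, \mathbf z B)$, with $\mathbf z$ a row vector.
\<close>

definition row_subst :: "complex mat \<Rightarrow> nat \<Rightarrow> cpoly" where
  "row_subst B k = (case k of
      0 \<Rightarrow> Var 0
    | Suc j \<Rightarrow> (\<Sum>i<dim_row B. Var (Suc i) * Const (B $$ (i, j))))"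

section \<open>Linear equivalence of multisets of vectors\<close>

definition linearly_equivalent ::
  "(complex \<Rightarrow> 'u \<Rightarrow> 'u::ab_group_add) \<Rightarrow> 'u multiset \<Rightarrow>
   (complex \<Rightarrow> 'w \<Rightarrow> 'w::ab_group_add) \<Rightarrow> 'w multiset \<Rightarrow> bool" where
  "linearly_equivalent sc E sc' E' \<longleftrightarrow>
    (\<exists>T. bij_betw T (module.span sc (set_mset E)) (module.span sc' (set_mset E')) \<and>
         (\<forall>x\<in>module.span sc (set_mset E). \<forall>y\<in>module.span sc (set_mset E).
            T (x + y) = T x + T y) \<and>
         (\<forall>c. \<forall>x\<in>module.span sc (set_mset E). T (sc c x) = sc' c (T x)) \<and>
         image_mset T E = E')"

text \<open>Pointwise scaling of complex-valued functions.\<close>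

definition fscale :: "complex \<Rightarrow> ('a \<Rightarrow> complex) \<Rightarrow> 'a \<Rightarrow> complex" where
  "fscale c f = (\<lambda>x. c * f x)"

section \<open>Finite-dimensional complex Lie algebras\<close>

locale complex_lie_algebra = vector_space scale
  for scale :: "complex \<Rightarrow> 'a \<Rightarrow> 'a::ab_group_add" +
  fixes bracket :: "'a \<Rightarrow> 'a \<Rightarrow> 'a"
  assumes finite_dimensional: "\<exists>S. finite S \<and> span S = UNIV"
    and bracket_linear_left: "Vector_Spaces.linear scale scale (\<lambda>x. bracket x y)"
    and bracket_linear_right: "Vector_Spaces.linear scale scale (\<lambda>y. bracket x y)"
    and bracket_alternating: "bracket x x = 0"
    and jacobi:
      "bracket x (bracket y z) + bracket y (bracket z x) + bracket z (bracket x y) = 0"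
begin

definition ad :: "'a \<Rightarrow> 'a \<Rightarrow> 'a" where
  "ad x = (\<lambda>y. bracket x y)"

definition bracket_set :: "'a set \<Rightarrow> 'a set \<Rightarrow> 'a set" where
  "bracket_set A B = span {bracket a b | a b. a \<in> A \<and> b \<in> B}"

primrec derived_series :: "nat \<Rightarrow> 'a set" where
  "derived_series 0 = UNIV"
| "derived_series (Suc k) = bracket_set (derived_series k) (derived_series k)"

definition solvable :: bool where
  "solvable \<longleftrightarrow> (\<exists>k. derived_series k = {0})"

definition lie_ideal :: "'a set \<Rightarrow> bool" where
  "lie_ideal I \<longleftrightarrow> subspace I \<and> (\<forall>x. \<forall>y\<in>I. bracket x y \<in> I)"

primrec lower_central_series :: "'a set \<Rightarrow> nat \<Rightarrow> 'a set" where
  "lower_central_series I 0 = I"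
| "lower_central_series I (Suc k) = bracket_set I (lower_central_series I k)"

definition nilpotent_ideal :: "'a set \<Rightarrow> bool" where
  "nilpotent_ideal I \<longleftrightarrow> lie_ideal I \<and> (\<exists>k. lower_central_series I k = {0})"

definition nilradical :: "'a set" where
  "nilradical = (THE N. nilpotent_ideal N \<and>
      (\<forall>I. nilpotent_ideal I \<and> N \<subseteq> I \<longrightarrow> I = N))"

definition complement :: "'a set \<Rightarrow> 'a set \<Rightarrow> bool" where
  "complement U V \<longleftrightarrow> subspace V \<and> U \<inter> V = {0} \<and> (\<forall>x. \<exists>u\<in>U. \<exists>v\<in>V. x = u + v)"

definition ordered_basis :: "'a list \<Rightarrow> 'a set \<Rightarrow> bool" where
  "ordered_basis bs V \<longleftrightarrow> distinct bs \<and> independent (set bs) \<and> span (set bs) = V"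

text \<open>
  Column \<open>j\<close> holds the coordinates of \<open>f (bs ! j)\<close>. This is the matrix of the restriction of
  \<open>f\<close> to the span of \<open>bs\<close> when \<open>f\<close> leaves that span invariant.
\<close>

definition matrix_of :: "'a list \<Rightarrow> ('a \<Rightarrow> 'a) \<Rightarrow> complex mat" where
  "matrix_of bs f = mat (length bs) (length bs)
     (\<lambda>(i, j). representation (set bs) (f (bs ! j)) (bs ! i))"

definition char_polynomial :: "'a list \<Rightarrow> cpoly" where
  "char_polynomial xs = det (Var 0 \<cdot>\<^sub>m 1\<^sub>m (length xs) +
     mat (length xs) (length xs)
       (\<lambda>(a, b). \<Sum>i<length xs. Var (Suc i) * Const (matrix_of xs (ad (xs ! i)) $$ (a, b))))"

definition e0 :: "'a list \<Rightarrow> nat" where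
  "e0 xs = (GREATEST k. Var 0 ^ k dvd char_polynomial xs)"

text \<open>
  A basis of the nilradical in which all \<open>ad y\<close> are upper triangular. For solvable algebras one
  exists by Lie's theorem, and the multiset of diagonal functionals is independent of the choice.
\<close>

definition triangular_basis :: "'a list" where
  "triangular_basis = (SOME bs. ordered_basis bs nilradical \<and>
      (\<forall>y. upper_triangular (matrix_of bs (ad y))))"

text \<open>
  The dual space of \<open>V\<close> is represented by the functions that are linear on \<open>V\<close> and zero
  outside \<open>V\<close>, a subspace of all complex-valued functions; so restricting to \<open>V\<close> means
  replacing the values outside \<open>V\<close> by zero.
\<close>

definition nilradical_weights :: "'a set \<Rightarrow> ('a \<Rightarrow> complex) multiset" where
  "nilradical_weights V =
     image_mset
       (\<lambda>i y. if y \<in> V then matrix_of triangular_basis (ad y) $$ (i, i) else 0)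
       (mset_set {..<length triangular_basis})"

definition nonzero_nilradical_weights :: "'a set \<Rightarrow> ('a \<Rightarrow> complex) multiset" where
  "nonzero_nilradical_weights V = filter_mset (\<lambda>w. w \<noteq> 0) (nilradical_weights V)"

end

text \<open>
  Spectral equivalence, with the characteristic polynomials computed in the bases \<open>xs\<close> and
  \<open>ys\<close>. It does not depend on these bases.
\<close>

definition spectrally_equivalent ::
  "(complex \<Rightarrow> 'a \<Rightarrow> 'a::ab_group_add) \<Rightarrow> ('a \<Rightarrow> 'a \<Rightarrow> 'a) \<Rightarrow> 'a list \<Rightarrow>
   (complex \<Rightarrow> 'b \<Rightarrow> 'b::ab_group_add) \<Rightarrow> ('b \<Rightarrow> 'b \<Rightarrow> 'b) \<Rightarrow> 'b list \<Rightarrow> bool" where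
  "spectrally_equivalent sc br xs sc' br' ys \<longleftrightarrow>
    length xs = length ys \<and>
    (\<exists>B \<in> carrier_mat (length xs) (length xs). invertible_mat B \<and>
       complex_lie_algebra.char_polynomial sc' br' ys =
       subst (row_subst B) (complex_lie_algebra.char_polynomial sc br xs))"

end

theory Submission
  imports Defs "HOL-Computational_Algebra.Fundamental_Theorem_Algebra"
begin

text \<open>
  For a solvable algebra the characteristic polynomial is a product of linear forms, one for each
  weight of the adjoint representation. By Lie's theorem (\<open>lie_theorem_mod\<close>) there is a basis in which
  all adjoint maps are triangular, and conjugating to it gives
  $Q(z_0, \mathbf{z}) = \prod_j (z_0 + \lambda_j(\sum_i z_i x_i))$ (\<open>char_polynomial_eq_prod\<close>). All
  brackets lie in the nilradical, so the weights on the quotient by it are zero, and up to zeros the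
  $\lambda_j$ are the weights on the nilradical. They vanish on the nilradical itself, so nothing is
  lost by restricting them to a complement (\<open>restricted_functionals_equivalent\<close>).

  A product of such linear forms determines the multiset of its factors
  (\<open>prod_linear_form_inject\<close>), and a substitution $\mathbf{z} \mapsto \mathbf{z}B$ acts on the factors
  by applying \<open>B\<close> to their coefficient vectors. So spectral equivalence says that the dimensions
  agree and some invertible matrix carries the multiset of all weights of one algebra to that of the
  other. The exponent $e_0$ counts the zero weights, and an isomorphism between the spans of the
  nonzero weights extends to an invertible matrix. Since the dimension is $e_0$ plus the number of
  nonzero weights, this is the stated criterion (\<open>image_mat_act_iff\<close>).

  Two devices keep the argument elementary. Lie's theorem is proved for pairs of ideals
  $U \subset W$, with all statements modulo \<open>U\<close>, so no quotient algebras are formed. And the nilradical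
  is identified as the common kernel of the weights of any triangularising basis: nilpotent ideals are
  exactly the ideals on which all weights vanish, so a largest one exists.
\<close>

section \<open>Substitution and products of linear forms\<close>

lemma Const_0 [simp]: "Const 0 = 0" by (simp add: Const_def)
lemma Const_1 [simp]: "Const 1 = 1" by (simp add: Const_def)
lemma Const_add: "Const (a + b) = Const a + Const b" by (simp add: Const_def single_add)
lemma Const_mult: "Const (a * b) = Const a * Const b" by (simp add: Const_def mult_single)
lemma Const_sum: "Const (sum f A) = (\<Sum>x\<in>A. Const (f x))"
  by (induction A rule: infinite_finite_induct) (simp_all add: Const_add)

definition monom_subst :: "(nat \<Rightarrow> cpoly) \<Rightarrow> (nat \<Rightarrow>\<^sub>0 nat) \<Rightarrow> cpoly" where
  "monom_subst f m = (\<Prod>i\<in>Poly_Mapping.keys m. f i ^ Poly_Mapping.lookup m i)"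

lemma monom_subst_superset:
  assumes "finite S" "Poly_Mapping.keys m \<subseteq> S"
  shows "monom_subst f m = (\<Prod>i\<in>S. f i ^ Poly_Mapping.lookup m i)"
  unfolding monom_subst_def
  using assms by (intro prod.mono_neutral_left) (auto simp: in_keys_iff)

lemma monom_subst_add: "monom_subst f (m + n) = monom_subst f m * monom_subst f n"
proof -
  let ?S = "Poly_Mapping.keys m \<union> Poly_Mapping.keys n"
  have "monom_subst f (m + n) = (\<Prod>i\<in>?S. f i ^ Poly_Mapping.lookup (m + n) i)"
    by (rule monom_subst_superset) (simp_all add: Poly_Mapping.keys_add)
  then show ?thesis
    by (simp add: monom_subst_superset[of ?S m] monom_subst_superset[of ?S n]
        lookup_add power_add prod.distrib)
qed

lemma subst_superset:
  assumes "finite S" "Poly_Mapping.keys p \<subseteq> S"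
  shows "subst f p = (\<Sum>m\<in>S. Const (Poly_Mapping.lookup p m) * monom_subst f m)"
  unfolding subst_def monom_subst_def
  using assms by (intro sum.mono_neutral_left) (auto simp: in_keys_iff)

lemma subst_add: "subst f (p + q) = subst f p + subst f q"
proof -
  let ?S = "Poly_Mapping.keys p \<union> Poly_Mapping.keys q"
  have "subst f (p + q) = (\<Sum>m\<in>?S. Const (Poly_Mapping.lookup (p + q) m) * monom_subst f m)"
    by (rule subst_superset) (simp_all add: Poly_Mapping.keys_add)
  then show ?thesis
    by (simp add: subst_superset[of ?S p] subst_superset[of ?S q]
        lookup_add Const_add distrib_right sum.distrib)
qed

lemma subst_0 [simp]: "subst f 0 = 0"
  by (simp add: subst_def)

lemma subst_sum: "subst f (sum g A) = (\<Sum>x\<in>A. subst f (g x))"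
  by (induction A rule: infinite_finite_induct) (simp_all add: subst_add)

lemma subst_single: "subst f (Poly_Mapping.single m c) = Const c * monom_subst f m"
  by (subst subst_superset[of "{m}"]) (simp_all)

lemma sum_of_monomials:
  "p = (\<Sum>m\<in>Poly_Mapping.keys p. Poly_Mapping.single m (Poly_Mapping.lookup p m))"
  by (rule poly_mapping_eqI) (simp add: lookup_sum lookup_single when_def in_keys_iff)

text \<open>
  \<^const>\<open>subst\<close> is additive, and it is multiplicative on monomials because exponents add; the
  general case follows by expanding both factors into monomials.
\<close>

lemma subst_mult: "subst f (p * q) = subst f p * subst f q"
proof -
  let ?p = "\<lambda>m. Poly_Mapping.single m (Poly_Mapping.lookup p m)"
  let ?q = "\<lambda>m. Poly_Mapping.single m (Poly_Mapping.lookup q m)"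
  have "subst f (?p m * ?q n) = subst f (?p m) * subst f (?q n)" for m n
    by (simp add: mult_single subst_single Const_mult monom_subst_add algebra_simps)
  then have "subst f ((\<Sum>m\<in>Poly_Mapping.keys p. ?p m) * (\<Sum>n\<in>Poly_Mapping.keys q. ?q n))
    = subst f (\<Sum>m\<in>Poly_Mapping.keys p. ?p m) * subst f (\<Sum>n\<in>Poly_Mapping.keys q. ?q n)"
    by (simp add: sum_product subst_sum)
  then show ?thesis by (simp flip: sum_of_monomials)
qed

lemma subst_Const [simp]: "subst f (Const c) = Const c"
  by (simp add: Const_def subst_single monom_subst_def)

lemma subst_1 [simp]: "subst f 1 = 1"
  using subst_Const[of f 1] by simp

lemma subst_Var [simp]: "subst f (Var i) = f i"
  by (simp add: Var_def subst_single monom_subst_def)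

lemma subst_prod_mset: "subst f (prod_mset M) = prod_mset (image_mset (subst f) M)"
  by (induction M) (simp_all add: subst_mult)

text \<open>
  A linear functional with coordinates \<open>c\<close> enters the characteristic polynomial as this factor, with
  leading term $z_0$. The normalisation matters: distinct coordinate vectors give factors that are
  not even associated, so no scalars interfere when factorisations are compared.
\<close>

definition linear_form :: "nat \<Rightarrow> (nat \<Rightarrow> complex) \<Rightarrow> cpoly" where
  "linear_form n c = Var 0 + (\<Sum>i<n. Var (Suc i) * Const (c i))"

text \<open>
  A copy of $\mathbb{C}^n$ inside a fixed function type, so that the dimension can vary with the
  algebra and both algebras can be compared in one type.
\<close>

definition coord_space :: "nat \<Rightarrow> (nat \<Rightarrow> complex) set" where
  "coord_space n = {c. \<forall>i\<ge>n. c i = 0}"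

lemma lookup_linear_form:
  "Poly_Mapping.lookup (linear_form n c) (Poly_Mapping.single k 1)
    = (case k of 0 \<Rightarrow> 1 | Suc i \<Rightarrow> if i < n then c i else 0)"
proof -
  have inj: "Poly_Mapping.single a (1::nat) = Poly_Mapping.single b 1 \<longleftrightarrow> a = b" for a b :: nat
    by (metis keys_single singleton_inject zero_neq_one)
  have "Var (Suc j) * Const (c j) = Poly_Mapping.single (Poly_Mapping.single (Suc j) 1) (c j)" for j
    by (simp add: Var_def Const_def mult_single)
  then show ?thesis
    by (auto simp: linear_form_def lookup_add lookup_sum lookup_single inj Var_def[of 0] when_def
        split: nat.split simp del: One_nat_def single_one)
qed

lemma linear_form_eq_iff:
  assumes "c \<in> coord_space n" "d \<in> coord_space n"
  shows "linear_form n c = linear_form n d \<longleftrightarrow> c = d"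
proof
  assume eq: "linear_form n c = linear_form n d"
  show "c = d"
  proof
    fix i show "c i = d i"
      using assms lookup_linear_form[of n c "Suc i"] lookup_linear_form[of n d "Suc i"] eq
      by (cases "i < n") (auto simp: coord_space_def)
  qed
qed simp

text \<open>
  Replaces $z_0$ by the value $-\sum_i a_i z_{i+1}$ that makes the linear form with coordinates \<open>a\<close>
  vanish.
\<close>

definition root_subst :: "nat \<Rightarrow> (nat \<Rightarrow> complex) \<Rightarrow> nat \<Rightarrow> cpoly" where
  "root_subst n a i = (if i = 0 then Var 0 - linear_form n a else Var i)"

lemma subst_root_linear_form:
  "subst (root_subst n a) (linear_form n c) = linear_form n c - linear_form n a"
  by (simp add: linear_form_def subst_add subst_sum subst_mult root_subst_def)

text \<open>
  Vanishing at the root of the form of \<open>a\<close> detects the factor \<open>a\<close>: the polynomial ring has no zero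
  divisors, so one factor must vanish, and the factor of \<open>c\<close> becomes the form with coordinates
  \<open>c - a\<close>.
\<close>

lemma linear_form_root_unique:
  assumes "a \<in> coord_space n" "set_mset A \<subseteq> coord_space n"
    and "subst (root_subst n a) (prod_mset (image_mset (linear_form n) A)) = 0"
  shows "a \<in># A"
proof -
  have "0 \<in># image_mset (\<lambda>c. linear_form n c - linear_form n a) A"
    using assms(3)
    by (simp add: subst_prod_mset image_mset.compositionality o_def subst_root_linear_form
        prod_mset_zero_iff)
  then obtain c where c: "c \<in># A" "linear_form n c = linear_form n a" by auto
  then have "c = a" using assms linear_form_eq_iff by blast
  then show ?thesis using c by simp
qed

lemma linear_form_nonzero: "linear_form n c \<noteq> 0"
  using lookup_linear_form[of n c 0] by auto

text \<open>
  Unique factorisation for products of linear forms. It rests on the absence of zero divisors: the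
  root of a factor on one side locates the same factor on the other side, and both are cancelled.
\<close>

theorem prod_linear_form_inject:
  assumes "set_mset A \<subseteq> coord_space n" "set_mset B \<subseteq> coord_space n"
    and "prod_mset (image_mset (linear_form n) A) = prod_mset (image_mset (linear_form n) B)"
  shows "A = B"
  using assms
proof (induction A arbitrary: B)
  case empty
  have "B = {#}"
  proof (rule ccontr)
    assume "B \<noteq> {#}"
    then obtain b where "b \<in># B" by blast
    then have "subst (root_subst n b) (prod_mset (image_mset (linear_form n) B)) = 0"
      by (auto simp: subst_prod_mset prod_mset_zero_iff subst_root_linear_form intro!: image_eqI)
    then show False using empty by simp
  qed
  then show ?case by simp
next
  case (add a A)
  have "subst (root_subst n a) (prod_mset (image_mset (linear_form n) (add_mset a A))) = 0"
    by (simp add: subst_mult subst_root_linear_form)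
  then have "a \<in># B" using linear_form_root_unique[of a n B] add.prems by simp
  then obtain B' where B: "B = add_mset a B'" by (metis insert_DiffM)
  then have "prod_mset (image_mset (linear_form n) A) = prod_mset (image_mset (linear_form n) B')"
    using add.prems(3) linear_form_nonzero[of n a] by simp
  then show ?case using add.IH add.prems B by simp
qed

lemma linear_form_0: "linear_form n 0 = Var 0"
  by (simp add: linear_form_def)

lemma mset_zero_nonzero:
  "C = replicate_mset (count C 0) 0 + filter_mset (\<lambda>c. c \<noteq> 0) C"
  by (metis filter_eq_replicate_mset multiset_partition)

text \<open>
  The factors equal to $z_0$ are those of the zero vectors. The product of the others stays
  nonzero under the substitution $z_0 = 0$, hence is not divisible by $z_0$.
\<close>

theorem Greatest_power_Var_dvd:
  assumes "set_mset A \<subseteq> coord_space n"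
  shows "(GREATEST k. Var 0 ^ k dvd prod_mset (image_mset (linear_form n) A)) = count A 0"
proof (rule Greatest_equality)
  define R where "R = prod_mset (image_mset (linear_form n) (filter_mset (\<lambda>c. c \<noteq> 0) A))"
  note A = mset_zero_nonzero[of A]
  have "prod_mset (image_mset (linear_form n)
      (replicate_mset (count A 0) 0 + filter_mset (\<lambda>c. c \<noteq> 0) A)) = Var 0 ^ count A 0 * R"
    by (simp add: R_def linear_form_0)
  then have P: "prod_mset (image_mset (linear_form n) A) = Var 0 ^ count A 0 * R"
    by (simp only: A[symmetric])
  then show "Var 0 ^ count A 0 dvd prod_mset (image_mset (linear_form n) A)" by simp
  have Var0: "Var 0 \<noteq> 0" using linear_form_nonzero[of n 0] linear_form_0 by metis
  fix k assume k: "Var 0 ^ k dvd prod_mset (image_mset (linear_form n) A)"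
  show "k \<le> count A 0"
  proof (rule ccontr)
    assume "\<not> k \<le> count A 0"
    then obtain d where "k = count A 0 + Suc d" by (metis add_Suc_right less_imp_Suc_add not_le)
    then have "Var 0 ^ Suc d dvd R" using k Var0 unfolding P by (simp add: power_add)
    then have "Var 0 dvd R" by (meson dvd_power dvd_trans zero_less_Suc)
    then obtain Q where "R = Var 0 * Q" by (elim dvdE)
    then have "subst (root_subst n 0) R = 0"
      by (simp add: subst_mult root_subst_def linear_form_0)
    then have "0 \<in># filter_mset (\<lambda>c. c \<noteq> 0) A"
      unfolding R_def using assms by (intro linear_form_root_unique) (auto simp: coord_space_def)
    then show False by simp
  qed
qed

text \<open>
  Multiplication by \<open>B\<close> on column vectors. Row vectors of variables are multiplied by \<open>B\<close> from the
  right, which on the coefficients of linear forms becomes this action.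
\<close>

definition mat_act :: "nat \<Rightarrow> complex mat \<Rightarrow> (nat \<Rightarrow> complex) \<Rightarrow> nat \<Rightarrow> complex" where
  "mat_act n B c i = (if i < n then \<Sum>j<n. B $$ (i, j) * c j else 0)"

lemma subst_row_subst_linear_form:
  assumes "B \<in> carrier_mat n n"
  shows "subst (row_subst B) (linear_form n c) = linear_form n (mat_act n B c)"
proof -
  have "subst (row_subst B) (linear_form n c)
    = Var 0 + (\<Sum>j<n. (\<Sum>i<n. Var (Suc i) * Const (B $$ (i, j))) * Const (c j))"
    using assms by (simp add: linear_form_def subst_add subst_sum subst_mult row_subst_def)
  also have "(\<Sum>j<n. (\<Sum>i<n. Var (Suc i) * Const (B $$ (i, j))) * Const (c j))
    = (\<Sum>i<n. \<Sum>j<n. Var (Suc i) * Const (B $$ (i, j)) * Const (c j))"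
    unfolding sum_distrib_right by (rule sum.swap)
  also have "\<dots> = (\<Sum>i<n. Var (Suc i) * Const (mat_act n B c i))"
    by (intro sum.cong refl) (simp add: mat_act_def Const_sum Const_mult sum_distrib_left mult.assoc)
  finally show ?thesis by (simp add: linear_form_def)
qed

lemma mat_act_coord_space: "mat_act n B c \<in> coord_space n"
  by (simp add: coord_space_def mat_act_def)

lemma mat_act_mult:
  assumes "A \<in> carrier_mat n n" "B \<in> carrier_mat n n"
  shows "mat_act n A (mat_act n B c) = mat_act n (A * B) c"
proof
  fix i
  show "mat_act n A (mat_act n B c) i = mat_act n (A * B) c i"
  proof (cases "i < n")
    case True
    have "mat_act n A (mat_act n B c) i = (\<Sum>k<n. \<Sum>j<n. A $$ (i, k) * B $$ (k, j) * c j)"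
      using True by (simp add: mat_act_def sum_distrib_left mult.assoc)
    also have "\<dots> = (\<Sum>j<n. \<Sum>k<n. A $$ (i, k) * B $$ (k, j) * c j)"
      by (rule sum.swap)
    also have "\<dots> = mat_act n (A * B) c i"
      using True assms
      by (simp add: mat_act_def scalar_prod_def sum_distrib_right atLeast0LessThan)
    finally show ?thesis .
  qed (simp add: mat_act_def)
qed

lemma mat_act_one: "c \<in> coord_space n \<Longrightarrow> mat_act n (1\<^sub>m n) c = c"
proof
  fix i assume c: "c \<in> coord_space n"
  show "mat_act n (1\<^sub>m n) c i = c i"
  proof (cases "i < n")
    case True
    then have "mat_act n (1\<^sub>m n) c i = (\<Sum>j<n. if j = i then c j else 0)"
      by (simp only: mat_act_def if_True, intro sum.cong) auto
    then show ?thesis using True by simp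
  qed (use c in \<open>simp add: mat_act_def coord_space_def\<close>)
qed

section \<open>Eigenvectors of an operator modulo an invariant subspace\<close>

text \<open>
  Otherwise the \<open>u i\<close> would be an infinite independent family.
\<close>

lemma (in vector_space) sequence_dependent_mod:
  assumes "finite S" and "span S = UNIV"
  shows "\<exists>n::nat. u n \<in> span (U \<union> u ` {..<n})"
proof (rule ccontr)
  assume "\<not> ?thesis"
  then have new: "u n \<notin> span (U \<union> u ` {..<n})" for n by blast
  have "independent (u ` {..<n}) \<and> card (u ` {..<n}) = n" for n
  proof (induction n)
    case (Suc n)
    have *: "u n \<notin> span (u ` {..<n})"
      using new[of n] span_mono[of "u ` {..<n}" "U \<union> u ` {..<n}"] by blast
    then have "u n \<notin> u ` {..<n}"
      using span_base[of "u n" "u ` {..<n}"] by blast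
    then show ?case
      using Suc * by (simp add: lessThan_Suc independent_insertI)
  qed (simp add: independent_empty)
  from this[of "Suc (card S)"] have "independent (u ` {..<Suc (card S)})"
    and "card (u ` {..<Suc (card S)}) = Suc (card S)" by blast+
  moreover have "u ` {..<Suc (card S)} \<subseteq> span S" using assms(2) by simp
  ultimately show False
    using independent_span_bound[OF assms(1)] by force
qed

text \<open>
  $p(f)\,w$, by the Horner scheme.
\<close>

definition (in vector_space) poly_apply :: "'a poly \<Rightarrow> ('b \<Rightarrow> 'b) \<Rightarrow> 'b \<Rightarrow> 'b" where
  "poly_apply p f w = fold_coeffs (\<lambda>a x. scale a w + f x) p 0"

context vector_space
begin

lemma
  assumes "Vector_Spaces.linear scale scale f"
  shows linear_op_add: "f (x + y) = f x + f y"
    and linear_op_scale: "f (scale c x) = scale c (f x)"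
    and linear_op_zero: "f 0 = 0"
    and linear_op_diff: "f (x - y) = f x - f y"
proof -
  interpret l: Vector_Spaces.linear scale scale f by fact
  show "f (x + y) = f x + f y" by (rule l.add)
  show "f (scale c x) = scale c (f x)" by (rule l.scale)
  show "f 0 = 0" by (rule l.zero)
  show "f (x - y) = f x - f y" by (rule l.diff)
qed

lemma poly_apply_0 [simp]: "poly_apply 0 f w = 0"
  by (simp add: poly_apply_def)

lemma poly_apply_pCons:
  assumes "Vector_Spaces.linear scale scale f"
  shows "poly_apply (pCons a p) f w = scale a w + f (poly_apply p f w)"
  using linear_op_zero[OF assms]
  by (cases "p = 0 \<and> a = 0") (auto simp: poly_apply_def fold_coeffs_def)

lemma poly_apply_add:
  assumes f: "Vector_Spaces.linear scale scale f"
  shows "poly_apply (p + q) f w = poly_apply p f w + poly_apply q f w"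
  by (induction p q rule: poly_induct2)
    (simp_all add: poly_apply_pCons[OF f] linear_op_add[OF f] scale_left_distrib)

lemma poly_apply_smult:
  assumes f: "Vector_Spaces.linear scale scale f"
  shows "poly_apply (smult c p) f w = scale c (poly_apply p f w)"
  by (induction p)
    (simp_all add: poly_apply_pCons[OF f] linear_op_scale[OF f] scale_right_distrib)

lemma poly_apply_linear_factor:
  assumes f: "Vector_Spaces.linear scale scale f"
  shows "poly_apply ([:- c, 1:] * q) f w = f (poly_apply q f w) - scale c (poly_apply q f w)"
proof -
  have "[:- c, 1:] * q = smult (- c) q + pCons 0 q" by simp
  then show ?thesis
    by (simp only: poly_apply_add[OF f] poly_apply_smult[OF f] poly_apply_pCons[OF f]) simp
qed

lemma poly_apply_monom:
  assumes f: "Vector_Spaces.linear scale scale f"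
  shows "poly_apply (monom 1 n) f w = (f ^^ n) w"
  by (induction n)
    (simp_all add: monom_0 monom_Suc poly_apply_pCons[OF f] linear_op_zero[OF f])

lemma poly_apply_mem:
  assumes f: "Vector_Spaces.linear scale scale f" and "subspace W" "\<And>x. x \<in> W \<Longrightarrow> f x \<in> W" "w \<in> W"
  shows "poly_apply p f w \<in> W"
  using assms(2-)
  by (induction p) (auto simp: poly_apply_pCons[OF f] subspace_0 subspace_add subspace_scale)

lemma span_invariant:
  assumes "Vector_Spaces.linear scale scale f" "subspace T" "\<And>x. x \<in> S \<Longrightarrow> f x \<in> T" "x \<in> span S"
  shows "f x \<in> T"
  using assms(4)
proof (induction rule: span_induct_alt)
  case base
  then show ?case using linear_op_zero[OF assms(1)] subspace_0[OF assms(2)] by simp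
next
  case (step c x y)
  then show ?case
    using assms by (simp add: linear_op_add[OF assms(1)] linear_op_scale[OF assms(1)] subspace_add subspace_scale)
qed

text \<open>
  Vectors in the span of \<open>U\<close> and $w, f w, \dots, f^{n-1} w$ have the form $p(f)\,w$ modulo \<open>U\<close>. The
  vanishing of \<open>coeff p n\<close> stands in for a degree bound: it is preserved by linear combinations
  without a case distinction for the zero polynomial, and suffices to make $X^n - p$ nonzero.
\<close>

lemma span_mod_powers:
  assumes f: "Vector_Spaces.linear scale scale f" and "subspace U"
    and "x \<in> span (U \<union> (\<lambda>i. (f ^^ i) w) ` {..<n})"
  shows "\<exists>p. coeff p n = 0 \<and> x - poly_apply p f w \<in> U"
proof -
  define X where "X = {x. \<exists>p. coeff p n = 0 \<and> x - poly_apply p f w \<in> U}"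
  have "subspace X"
  proof (rule subspaceI)
    show "0 \<in> X" unfolding X_def using subspace_0[OF assms(2)] by (auto intro!: exI[of _ 0])
  next
    fix x y assume "x \<in> X" "y \<in> X"
    then obtain p q where "coeff p n = 0" "x - poly_apply p f w \<in> U"
      "coeff q n = 0" "y - poly_apply q f w \<in> U" unfolding X_def by blast
    then have "coeff (p + q) n = 0" "(x + y) - poly_apply (p + q) f w \<in> U"
      using subspace_add[OF assms(2), of "x - poly_apply p f w" "y - poly_apply q f w"]
      by (simp_all add: poly_apply_add[OF f] algebra_simps)
    then show "x + y \<in> X" unfolding X_def by blast
  next
    fix c x assume "x \<in> X"
    then obtain p where "coeff p n = 0" "x - poly_apply p f w \<in> U" unfolding X_def by blast
    then have "coeff (smult c p) n = 0" "scale c x - poly_apply (smult c p) f w \<in> U"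
      using subspace_scale[OF assms(2), of "x - poly_apply p f w" c]
      by (simp_all add: poly_apply_smult[OF f] scale_right_diff_distrib)
    then show "scale c x \<in> X" unfolding X_def by blast
  qed
  moreover have "U \<union> (\<lambda>i. (f ^^ i) w) ` {..<n} \<subseteq> X"
  proof
    fix x assume "x \<in> U \<union> (\<lambda>i. (f ^^ i) w) ` {..<n}"
    then show "x \<in> X"
    proof
      assume "x \<in> U" then show ?thesis unfolding X_def by (auto intro!: exI[of _ 0])
    next
      assume "x \<in> (\<lambda>i. (f ^^ i) w) ` {..<n}"
      then obtain i where "i < n" "x = (f ^^ i) w" by blast
      then show ?thesis unfolding X_def using subspace_0[OF assms(2)]
        by (auto intro!: exI[of _ "monom 1 i"] simp: poly_apply_monom[OF f])
    qed
  qed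
  ultimately show ?thesis using span_minimal assms(3) unfolding X_def by blast
qed

end

text \<open>
  The eigenvector argument for the operator induced on \<open>W / U\<close>, phrased without a quotient space.
  Let \<open>q\<close> be a nonzero polynomial of least degree with $q(f)\,w \in U$. It is not constant, so it
  has a complex root \<open>c\<close>, and with $q = (X - c)\,r$ the vector $r(f)\,w$ is an eigenvector modulo \<open>U\<close>.
\<close>

lemma eigenvector_mod:
  fixes scale :: "complex \<Rightarrow> 'a \<Rightarrow> 'a::ab_group_add"
  assumes "vector_space scale" and fin: "finite S" "module.span scale S = UNIV"
    and f: "Vector_Spaces.linear scale scale f"
    and U: "module.subspace scale U"
    and W: "module.subspace scale W" "\<And>x. x \<in> W \<Longrightarrow> f x \<in> W"
    and w: "w \<in> W" "w \<notin> U"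
  shows "\<exists>v\<in>W. v \<notin> U \<and> (\<exists>c. f v - scale c v \<in> U)"
proof -
  interpret vector_space scale by fact
  obtain n where n: "(f ^^ n) w \<in> span (U \<union> (\<lambda>i. (f ^^ i) w) ` {..<n})"
    using sequence_dependent_mod[OF fin, of "\<lambda>i. (f ^^ i) w" U] by blast
  then obtain p where p: "coeff p n = 0" "(f ^^ n) w - poly_apply p f w \<in> U"
    using span_mod_powers[OF f U] by blast
  define P where "P q \<longleftrightarrow> q \<noteq> 0 \<and> poly_apply q f w \<in> U" for q :: "complex poly"
  have "coeff (monom 1 n + smult (-1) p) n = 1" using p by simp
  then have "monom 1 n + smult (-1) p \<noteq> 0" by (metis coeff_0 zero_neq_one)
  moreover have "poly_apply (monom 1 n + smult (-1) p) f w \<in> U"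
    using p(2) by (simp add: poly_apply_add[OF f] poly_apply_smult[OF f] poly_apply_monom[OF f] del: smult_minus_left)
  ultimately have "P (monom 1 n + smult (-1) p)" unfolding P_def by blast
  then obtain q where q: "P q" and least: "\<And>r. P r \<Longrightarrow> degree q \<le> degree r"
    using ex_has_least_nat[of P _ degree] by blast
  have "\<not> constant (poly q)"
  proof
    assume "constant (poly q)"
    then have "degree q = 0" using constant_degree by blast
    then obtain a where "q = [:a:]" by (metis degree_eq_zeroE)
    with q have "a \<noteq> 0" "scale a w \<in> U"
      by (auto simp: P_def poly_apply_pCons[OF f] linear_op_zero[OF f])
    then have "scale (inverse a) (scale a w) \<in> U" using U subspace_scale by blast
    with \<open>a \<noteq> 0\<close> w show False by simp
  qed
  then obtain c where "poly q c = 0" using fundamental_theorem_of_algebra by blast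
  then obtain r where r: "q = [:- c, 1:] * r" using poly_eq_0_iff_dvd dvdE by blast
  have "r \<noteq> 0" using q r by (auto simp: P_def)
  have "degree q = Suc (degree r)"
    unfolding r using \<open>r \<noteq> 0\<close> by (subst degree_mult_eq) auto
  then have "\<not> P r" using least by fastforce
  then have "poly_apply r f w \<notin> U" using \<open>r \<noteq> 0\<close> P_def by blast
  moreover have "poly_apply r f w \<in> W" using poly_apply_mem[OF f W w(1)] .
  moreover have "f (poly_apply r f w) - scale c (poly_apply r f w) \<in> U"
    using q unfolding P_def r poly_apply_linear_factor[OF f] by blast
  ultimately show ?thesis by blast
qed

section \<open>Lie's theorem\<close>

context complex_lie_algebra
begin

lemma bracket_add_left: "bracket (x + y) z = bracket x z + bracket y z"
  by (rule linear_op_add[OF bracket_linear_left])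

lemma bracket_add_right: "bracket z (x + y) = bracket z x + bracket z y"
  by (rule linear_op_add[OF bracket_linear_right])

lemma bracket_diff_left: "bracket (x - y) z = bracket x z - bracket y z"
  by (rule linear_op_diff[OF bracket_linear_left])

lemma bracket_diff_right: "bracket z (x - y) = bracket z x - bracket z y"
  by (rule linear_op_diff[OF bracket_linear_right])

lemma bracket_scale_left: "bracket (scale c x) z = scale c (bracket x z)"
  by (rule linear_op_scale[OF bracket_linear_left])

lemma bracket_scale_right: "bracket z (scale c x) = scale c (bracket z x)"
  by (rule linear_op_scale[OF bracket_linear_right])

lemma bracket_zero_left [simp]: "bracket 0 z = 0"
  by (rule linear_op_zero[OF bracket_linear_left])

lemma bracket_zero_right [simp]: "bracket z 0 = 0"
  by (rule linear_op_zero[OF bracket_linear_right])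

lemmas bracket_linear_simps =
  bracket_add_left bracket_add_right bracket_diff_left bracket_diff_right
  bracket_scale_left bracket_scale_right

lemma bracket_antisym: "bracket x y = - bracket y x"
proof -
  have "bracket x y + bracket y x = bracket (x + y) (x + y)"
    by (simp only: bracket_add_left bracket_add_right) (simp add: bracket_alternating)
  then have "bracket x y + bracket y x = 0" by (simp only: bracket_alternating)
  then show ?thesis by (rule eq_neg_iff_add_eq_0[THEN iffD2])
qed

lemma bracket_minus_right: "bracket x (- y) = - bracket x y"
  using bracket_diff_right[of x 0 y] by simp

lemma bracket_bracket_left:
  "bracket (bracket x y) z = bracket x (bracket y z) - bracket y (bracket x z)"
proof -
  have "bracket x (bracket y z) + bracket y (- bracket x z) + - bracket (bracket x y) z = 0"
    using jacobi[of x y z] bracket_antisym[of z x] bracket_antisym[of z "bracket x y"] by metis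
  then show ?thesis
    by (simp add: bracket_minus_right algebra_simps)
qed

lemma lie_ideal_subspace: "lie_ideal I \<Longrightarrow> subspace I"
  by (simp add: lie_ideal_def)

lemma lie_ideal_bracket: "lie_ideal I \<Longrightarrow> y \<in> I \<Longrightarrow> bracket x y \<in> I"
  by (simp add: lie_ideal_def)

lemma lie_ideal_bracket_left: 
  assumes "lie_ideal I" "y \<in> I"
  shows "bracket y x \<in> I"
  using lie_ideal_bracket[OF assms, of x] bracket_antisym[of y x]
    subspace_neg[OF lie_ideal_subspace[OF assms(1)]] by simp

lemma linear_bracket_minus_scalar:
  "Vector_Spaces.linear scale scale (\<lambda>y. bracket x y - scale c y)"
  by (auto simp: Vector_Spaces.linear_iff vector_space_axioms bracket_linear_simps algebra_simps)

text \<open>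
  The invariance lemma behind Lie's theorem, modulo \<open>U\<close>. Put $u_i = (\operatorname{ad} z)^i w$ and
  let $L_i$ be the span of \<open>U\<close> and $u_0, \dots, u_{i-1}$. Induction on \<open>i\<close> gives
  $[k, u_{i+1}] \equiv \lambda(k)\, u_{i+1} + (i+1)\, \lambda([k,z])\, u_i$ modulo $L_i$. At the
  first \<open>m\<close> with $u_{m+1} \in L_{m+1}$, the operator $k - \lambda(k)$ maps $u_{m+1}$ into $L_m$, which
  forces $(m+1)\,\lambda([k,z])\,u_m \in L_m$ and thus $\lambda([k,z]) = 0$. Tracking this one
  off-diagonal coefficient replaces the usual comparison of traces, and characteristic zero enters
  when dividing by $m + 1$.
\<close>

lemma weight_vanishes_on_brackets:
  assumes U: "lie_ideal U" and K: "\<And>k. k \<in> K \<Longrightarrow> bracket k z \<in> K"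
    and w: "w \<notin> U" and l: "\<And>k. k \<in> K \<Longrightarrow> bracket k w - scale (l k) w \<in> U"
    and k: "k \<in> K"
  shows "l (bracket k z) = 0"
proof -
  define u where "u i = (bracket z ^^ i) w" for i
  define L where "L i = span (U \<union> u ` {..<i})" for i
  have u_Suc: "u (Suc i) = bracket z (u i)" for i by (simp add: u_def)
  have L: "subspace (L i)" for i by (simp add: L_def)
  have U_L: "U \<subseteq> L i" for i unfolding L_def using span_superset by blast
  have u_L: "u i \<in> L j" if "i < j" for i j unfolding L_def using that by (intro span_base) blast
  have L_mono: "L i \<subseteq> L j" if "i \<le> j" for i j unfolding L_def using that by (intro span_mono) auto
  have L_0: "L 0 = U" unfolding L_def using lie_ideal_subspace[OF U] by simp
  have z_L: "bracket z x \<in> L (Suc i)" if "x \<in> L i" for x i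
  proof (rule span_invariant[OF bracket_linear_right L _ that[unfolded L_def]])
    fix y assume "y \<in> U \<union> u ` {..<i}"
    then show "bracket z y \<in> L (Suc i)"
      using lie_ideal_bracket[OF U] U_L[of "Suc i"] u_L by (auto simp flip: u_Suc)
  qed
  \<comment> \<open>At \<open>i = 0\<close> the truncated index \<open>i - 1\<close> is harmless: the coefficient of \<open>u (i - 1)\<close> is zero.\<close>
  have strong: "bracket k (u i) - scale (l k) (u i)
      - scale (of_nat i * l (bracket k z)) (u (i - 1)) \<in> L (i - 1)" if "k \<in> K" for k i
    using that
  proof (induction i arbitrary: k)
    case 0
    then show ?case using l L_0 by (simp add: u_def)
  next
    case (Suc i)
    define r where "r = bracket k (u i) - scale (l k) (u i)
      - scale (of_nat i * l (bracket k z)) (u (i - 1))"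
    have r: "r \<in> L (i - 1)" using Suc r_def by blast
    have zr: "bracket z r \<in> L i"
      using r z_L[of r "i - 1"] lie_ideal_bracket[OF U] L_0 by (cases i) auto
    define s where "s = bracket (bracket k z) (u i) - scale (l (bracket k z)) (u i)"
    have s: "s \<in> L i"
    proof -
      have kz: "bracket k z \<in> K" using K Suc.prems by blast
      define c where "c = of_nat i * l (bracket (bracket k z) z)"
      have "s - scale c (u (i - 1)) \<in> L i"
        using Suc.IH[OF kz] L_mono[of "i - 1" i] by (auto simp: s_def c_def)
      moreover have "scale c (u (i - 1)) \<in> L i"
        using u_L[of "i - 1" i] L[of i] subspace_scale subspace_0 by (cases i) (auto simp: c_def)
      ultimately show ?thesis using subspace_add[OF L] by fastforce
    qed
    \<comment> \<open>Both sides vanish at \<open>i = 0\<close>, where the truncated predecessor has no meaning.\<close>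
    have shift: "scale (of_nat i * l (bracket k z)) (bracket z (u (i - 1)))
      = scale (of_nat i * l (bracket k z)) (u i)"
      by (cases i) (simp_all add: u_Suc)
    have "bracket k (u (Suc i)) = bracket z (bracket k (u i)) + bracket (bracket k z) (u i)"
      unfolding u_Suc by (simp add: bracket_bracket_left)
    also have "bracket z (bracket k (u i))
      = bracket z r + scale (l k) (u (Suc i)) + scale (of_nat i * l (bracket k z)) (u i)"
      unfolding r_def bracket_diff_right bracket_scale_right shift u_Suc by simp
    also have "bracket (bracket k z) (u i) = s + scale (l (bracket k z)) (u i)"
      by (simp add: s_def)
    finally have "bracket k (u (Suc i)) - scale (l k) (u (Suc i))
        - scale (of_nat (Suc i) * l (bracket k z)) (u i) = bracket z r + s"
      by (simp add: algebra_simps)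
    then show ?case using subspace_add[OF L zr s] by simp
  qed
  \<comment> \<open>Modulo \<open>L i\<close>, every vector of \<open>L (Suc i)\<close> is an eigenvector of \<open>k\<close>.\<close>
  have lower: "bracket k x - scale (l k) x \<in> L i" if "x \<in> L (Suc i)" for x i
  proof (rule span_invariant[OF linear_bracket_minus_scalar L _ that[unfolded L_def]])
    fix y assume "y \<in> U \<union> u ` {..<Suc i}"
    then show "bracket k y - scale (l k) y \<in> L i"
    proof
      assume "y \<in> U"
      then have "bracket k y - scale (l k) y \<in> U"
        using U by (simp add: lie_ideal_def subspace_diff subspace_scale)
      then show ?thesis using U_L by blast
    next
      assume "y \<in> u ` {..<Suc i}"
      then obtain j where j: "j \<le> i" "y = u j" by (auto simp: less_Suc_eq_le)
      define c where "c = of_nat j * l (bracket k z)"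
      have "L (j - 1) \<subseteq> L i" using j by (intro L_mono) simp
      then have "bracket k y - scale (l k) y - scale c (u (j - 1)) \<in> L i"
        using strong[OF k, of j] j by (auto simp: c_def)
      moreover have "scale c (u (j - 1)) \<in> L i"
        using u_L[of "j - 1" i] j L[of i] subspace_scale subspace_0 by (cases j) (auto simp: c_def)
      ultimately show ?thesis using subspace_add[OF L] by fastforce
    qed
  qed
  have "\<exists>n. u n \<in> L n"
    unfolding L_def using finite_dimensional sequence_dependent_mod by blast
  then obtain n where n: "u n \<in> L n" and least: "\<And>m. u m \<in> L m \<Longrightarrow> n \<le> m"
    using exists_least_iff[of "\<lambda>n. u n \<in> L n"] not_less by metis
  have "n \<noteq> 0"
    using n w L_0 by (metis funpow_0 u_def)
  then obtain m where m: "n = Suc m" by (metis not0_implies_Suc)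
  have um: "u m \<notin> L m" using least[of m] m by auto
  define a where "a = of_nat (Suc m) * l (bracket k z)"
  have "scale a (u m) \<in> L m"
    using subspace_diff[OF L lower[of "u (Suc m)" m] strong[OF k, of "Suc m", simplified]] n m
    by (simp add: a_def)
  then have "scale (inverse a) (scale a (u m)) \<in> L m" by (rule subspace_scale[OF L])
  then have "a = 0" using um by (cases "a = 0") simp_all
  moreover have "of_nat (Suc m) \<noteq> (0::complex)" by (simp only: of_nat_eq_0_iff)
  ultimately show ?thesis by (simp add: a_def del: of_nat_Suc)
qed

lemma subspace_scalar_mod:
  assumes "subspace U"
  shows "subspace {x. \<exists>c. bracket x v - scale c v \<in> U}"
proof (rule subspaceI)
  show "0 \<in> {x. \<exists>c. bracket x v - scale c v \<in> U}"
    using subspace_0[OF assms] by (auto intro!: exI[of _ 0])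
next
  fix x y assume "x \<in> {x. \<exists>c. bracket x v - scale c v \<in> U}" "y \<in> {x. \<exists>c. bracket x v - scale c v \<in> U}"
  then obtain c d where "bracket x v - scale c v \<in> U" "bracket y v - scale d v \<in> U" by blast
  from subspace_add[OF assms this] have "bracket (x + y) v - scale (c + d) v \<in> U"
    by (simp add: bracket_add_left algebra_simps)
  then show "x + y \<in> {x. \<exists>c. bracket x v - scale c v \<in> U}" by blast
next
  fix a x assume "x \<in> {x. \<exists>c. bracket x v - scale c v \<in> U}"
  then obtain c where "bracket x v - scale c v \<in> U" by blast
  from subspace_scale[OF assms this, of a] have "bracket (scale a x) v - scale (a * c) v \<in> U"
    by (simp add: bracket_scale_left scale_right_diff_distrib)
  then show "scale a x \<in> {x. \<exists>c. bracket x v - scale c v \<in> U}" by blast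
qed

text \<open>
  The inductive step of Lie's theorem. By the invariance lemma the joint weight space of \<open>K\<close> is stable
  under \<open>z\<close>, so it contains an eigenvector of \<open>z\<close>, which is then a joint weight vector for the span
  of both.
\<close>

lemma weight_vector_extend:
  assumes U: "lie_ideal U" and W: "lie_ideal W" and K: "\<And>k. k \<in> K \<Longrightarrow> bracket k z \<in> K"
    and "w \<in> W" "w \<notin> U" "\<forall>k\<in>K. \<exists>c. bracket k w - scale c w \<in> U"
  shows "\<exists>v\<in>W. v \<notin> U \<and> (\<forall>k\<in>span (insert z K). \<exists>c. bracket k v - scale c v \<in> U)"
proof -
  obtain l where l: "\<And>k. k \<in> K \<Longrightarrow> bracket k w - scale (l k) w \<in> U"
    using assms(6) by metis
  \<comment> \<open>The joint weight space of \<open>K\<close> for the weight \<open>l\<close>, modulo \<open>U\<close>.\<close>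
  define X where "X = {x \<in> W. \<forall>k\<in>K. bracket k x - scale (l k) x \<in> U}"
  have sub: "subspace U" "subspace W" using U W lie_ideal_subspace by auto
  have "subspace X"
  proof (rule subspaceI)
    show "0 \<in> X" using sub by (simp add: X_def subspace_0)
  next
    fix x y assume "x \<in> X" "y \<in> X"
    moreover have "bracket k (x + y) - scale (l k) (x + y) =
      (bracket k x - scale (l k) x) + (bracket k y - scale (l k) y)" for k
      by (simp add: bracket_add_right algebra_simps)
    ultimately show "x + y \<in> X" using sub by (simp add: X_def subspace_add)
  next
    fix c x assume "x \<in> X"
    moreover have "bracket k (scale c x) - scale (l k) (scale c x) =
      scale c (bracket k x - scale (l k) x)" for k
      by (simp add: bracket_scale_right algebra_simps)
    ultimately show "scale c x \<in> X" using sub by (simp add: X_def subspace_scale)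
  qed
  moreover have "bracket z x \<in> X" if "x \<in> X" for x
  proof -
    have "bracket k (bracket z x) - scale (l k) (bracket z x) \<in> U" if k: "k \<in> K" for k
    proof -
      have *: "l (bracket k z) = 0"
        using weight_vanishes_on_brackets[OF U K _ l k] assms(5) by blast
      have "bracket k (bracket z x) - scale (l k) (bracket z x)
        = bracket z (bracket k x - scale (l k) x)
          + (bracket (bracket k z) x - scale (l (bracket k z)) x)"
        unfolding * by (simp add: bracket_bracket_left bracket_linear_simps)
      moreover have "bracket z (bracket k x - scale (l k) x) \<in> U"
        using \<open>x \<in> X\<close> k lie_ideal_bracket[OF U] by (simp add: X_def)
      moreover have "bracket (bracket k z) x - scale (l (bracket k z)) x \<in> U"
        using \<open>x \<in> X\<close> K[OF k] by (simp add: X_def)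
      ultimately show ?thesis using subspace_add[OF sub(1)] by simp
    qed
    then show ?thesis using that lie_ideal_bracket[OF W] by (simp add: X_def)
  qed
  moreover have "w \<in> X" using assms l by (simp add: X_def)
  moreover obtain S where "finite S" "span S = UNIV" using finite_dimensional by blast
  ultimately obtain v c where v: "v \<in> X" "v \<notin> U" "bracket z v - scale c v \<in> U"
    using eigenvector_mod[OF vector_space_axioms _ _ bracket_linear_right sub(1), of S X z w] assms(5)
    by blast
  have "insert z K \<subseteq> {x. \<exists>c. bracket x v - scale c v \<in> U}"
    using v by (auto simp: X_def)
  then have "span (insert z K) \<subseteq> {x. \<exists>c. bracket x v - scale c v \<in> U}"
    by (rule span_minimal[OF _ subspace_scalar_mod[OF sub(1)]])
  then show ?thesis using v by (auto simp: X_def)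
qed

lemma subspace_finite_span:
  assumes "subspace W"
  shows "\<exists>F. finite F \<and> F \<subseteq> W \<and> span F = W"
proof -
  obtain S where S: "finite S" "span S = UNIV" using finite_dimensional by blast
  obtain B where B: "B \<subseteq> W" "independent B" "W \<subseteq> span B"
    using maximal_independent_subset by blast
  then have "finite B" using independent_span_bound[OF S(1)] S by simp
  moreover have "span B = W" using B assms span_minimal by blast
  ultimately show ?thesis using B by blast
qed

lemma subspace_derived_series: "subspace (derived_series j)"
  by (cases j) (simp_all add: bracket_set_def)

lemma bracket_set_mono: "A \<subseteq> A' \<Longrightarrow> B \<subseteq> B' \<Longrightarrow> bracket_set A B \<subseteq> bracket_set A' B'"
  unfolding bracket_set_def by (rule span_mono) blast

lemma bracket_in_bracket_set: "a \<in> A \<Longrightarrow> b \<in> B \<Longrightarrow> bracket a b \<in> bracket_set A B"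
  unfolding bracket_set_def by (rule span_base) blast

lemma derived_series_decreasing: "derived_series (Suc j) \<subseteq> derived_series j"
proof (induction j)
  case (Suc j)
  then show ?case using bracket_set_mono[OF Suc Suc] by simp
qed simp

text \<open>
  Between two consecutive terms of the derived series every subspace is stable under brackets with
  the larger term. So the spanning vectors of the larger term can be added one at a time.
\<close>

lemma weight_vector_derived_series:
  assumes U: "lie_ideal U" and W: "lie_ideal W"
    and step: "\<exists>w\<in>W. w \<notin> U \<and> (\<forall>k\<in>derived_series (Suc j). \<exists>c. bracket k w - scale c w \<in> U)"
  shows "\<exists>w\<in>W. w \<notin> U \<and> (\<forall>k\<in>derived_series j. \<exists>c. bracket k w - scale c w \<in> U)"
proof -
  let ?D = "derived_series (Suc j)"
  obtain F where F: "finite F" "F \<subseteq> derived_series j" "span F = derived_series j"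
    using subspace_finite_span[OF subspace_derived_series] by blast
  have "\<exists>w\<in>W. w \<notin> U \<and> (\<forall>k\<in>span (?D \<union> F). \<exists>c. bracket k w - scale c w \<in> U)"
    using F(1,2)
  proof (induction F rule: finite_induct)
    case empty
    have "span (?D \<union> {}) = ?D"
      using subspace_derived_series[of "Suc j"] by (simp del: derived_series.simps)
    then show ?case using step by (simp only:)
  next
    case (insert z F)
    let ?K = "span (?D \<union> F)"
    have "?K \<subseteq> derived_series j"
      using span_minimal[OF _ subspace_derived_series[of j]] derived_series_decreasing[of j] insert.prems
      by blast
    then have "bracket k z \<in> ?K" if "k \<in> ?K" for k
      using that insert.prems bracket_in_bracket_set[of k "derived_series j" z "derived_series j"]
        span_base[of "bracket k z" "?D \<union> F"] by auto
    then have "\<exists>v\<in>W. v \<notin> U \<and> (\<forall>k\<in>span (insert z ?K). \<exists>c. bracket k v - scale c v \<in> U)"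
      using weight_vector_extend[OF U W, of ?K z] insert.IH insert.prems by blast
    moreover have "span (?D \<union> insert z F) \<subseteq> span (insert z ?K)"
    proof (rule span_mono)
      show "?D \<union> insert z F \<subseteq> insert z ?K" using span_superset[of "?D \<union> F"] by blast
    qed
    ultimately show ?case by blast
  qed
  moreover have "derived_series j \<subseteq> span (?D \<union> F)"
    using span_mono[of F "?D \<union> F"] F(3) by auto
  ultimately show ?thesis by blast
qed

text \<open>
  Lie's theorem for the adjoint action on the quotient of two ideals: climb up the derived series
  from \<open>{0}\<close> to the whole algebra.
\<close>

theorem lie_theorem_mod:
  assumes "solvable" and U: "lie_ideal U" and W: "lie_ideal W" and "w \<in> W" "w \<notin> U"
  shows "\<exists>w\<in>W. w \<notin> U \<and> (\<forall>x. \<exists>c. bracket x w - scale c w \<in> U)"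
proof -
  obtain n where n: "derived_series n = {0}" using assms(1) solvable_def by blast
  have "0 \<in> U" using U lie_ideal_subspace subspace_0 by blast
  then have "\<exists>w\<in>W. w \<notin> U \<and> (\<forall>k\<in>derived_series n. \<exists>c. bracket k w - scale c w \<in> U)"
    using n assms(4,5) by (auto intro!: bexI[of _ w] exI[of _ 0])
  then have "\<exists>w\<in>W. w \<notin> U \<and> (\<forall>k\<in>derived_series 0. \<exists>c. bracket k w - scale c w \<in> U)"
    by (induction n) (use weight_vector_derived_series[OF U W] in blast)+
  then show ?thesis by simp
qed

end

section \<open>Flags, weights and the nilradical\<close>

context complex_lie_algebra
begin

text \<open>
  The initial segments of \<open>bs\<close> span a chain of ideals, and each \<open>bs ! j\<close> is a weight vector modulo
  the preceding ones.
\<close>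

definition flag :: "'a list \<Rightarrow> bool" where
  "flag bs \<longleftrightarrow> (\<forall>x. \<forall>j<length bs. \<exists>c.
     bracket x (bs ! j) - scale c (bs ! j) \<in> span (set (take j bs)))"

definition weight :: "'a list \<Rightarrow> nat \<Rightarrow> 'a \<Rightarrow> complex" where
  "weight bs j x = representation (set bs) (bracket x (bs ! j)) (bs ! j)"

lemma matrix_of_ad_diagonal:
  "j < length bs \<Longrightarrow> matrix_of bs (ad x) $$ (j, j) = weight bs j x"
  by (simp add: matrix_of_def ad_def weight_def)

lemma ordered_basisD:
  assumes "ordered_basis bs W"
  shows "distinct bs" "independent (set bs)" "span (set bs) = W"
  using assms by (auto simp: ordered_basis_def)

lemma ordered_basis_expansion:
  assumes bs: "ordered_basis bs W" and v: "v \<in> W"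
  shows "(\<Sum>i<length bs. scale (representation (set bs) v (bs ! i)) (bs ! i)) = v"
proof -
  have "(\<Sum>b\<in>set bs. scale (representation (set bs) v b) b) = v"
    using ordered_basisD[OF bs] v by (intro sum_representation_eq) auto
  then show ?thesis
    using sum.reindex_bij_betw[OF bij_betw_nth[OF ordered_basisD(1)[OF bs] refl refl],
        of "\<lambda>b. scale (representation (set bs) v b) b"] by simp
qed

lemma representation_nth:
  assumes bs: "ordered_basis bs W" and "i < length bs" "j < length bs"
  shows "representation (set bs) (bs ! i) (bs ! j) = (if i = j then 1 else 0)"
  using ordered_basisD[OF bs] assms(2,3)
  by (auto simp: representation_basis nth_eq_iff_index_eq)

lemma representation_take_eq_0:
  assumes bs: "ordered_basis bs W" and "v \<in> span (set (take j bs))" "j \<le> i" "i < length bs"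
  shows "representation (set bs) v (bs ! i) = 0"
proof -
  have "bs ! i \<notin> set (take j bs)"
    using ordered_basisD(1)[OF bs] assms(3,4) by (auto simp: in_set_conv_nth nth_eq_iff_index_eq)
  moreover have "representation (set bs) v = representation (set (take j bs)) v"
    by (rule representation_extend[OF ordered_basisD(2)[OF bs] assms(2) set_take_subset])
  ultimately show ?thesis using representation_ne_zero by metis
qed

lemma span_takeI:
  assumes bs: "ordered_basis bs W" and v: "v \<in> W"
    and 0: "\<And>i. j \<le> i \<Longrightarrow> i < length bs \<Longrightarrow> representation (set bs) v (bs ! i) = 0"
  shows "v \<in> span (set (take j bs))"
proof -
  have "scale (representation (set bs) v (bs ! i)) (bs ! i) \<in> span (set (take j bs))"
    if i: "i < length bs" for i
  proof (cases "i < j")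
    case True
    then have "bs ! i \<in> set (take j bs)" using i by (auto simp: in_set_conv_nth)
    then show ?thesis by (intro span_scale span_base)
  next
    case False
    then show ?thesis using 0 i by (simp add: span_zero)
  qed
  then have "(\<Sum>i<length bs. scale (representation (set bs) v (bs ! i)) (bs ! i))
      \<in> span (set (take j bs))"
    by (intro span_sum) auto
  then show ?thesis using ordered_basis_expansion[OF bs v] by simp
qed

lemma nth_in_span_take: "j < i \<Longrightarrow> j < length bs \<Longrightarrow> bs ! j \<in> span (set (take i bs))"
  by (rule span_base) (auto simp: in_set_conv_nth)

lemma span_take_mono: "i \<le> j \<Longrightarrow> span (set (take i bs)) \<subseteq> span (set (take j bs))"
  by (intro span_mono set_take_subset_set_take)

lemma nth_notin_span_take:
  assumes bs: "ordered_basis bs W" and "j < length bs"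
  shows "bs ! j \<notin> span (set (take j bs))"
  using representation_take_eq_0[OF bs, of "bs ! j" j j] representation_nth[OF bs, of j j] assms(2)
  by auto

lemma flag_bracket_weight:
  assumes bs: "ordered_basis bs W" "flag bs" and j: "j < length bs"
  shows "bracket x (bs ! j) - scale (weight bs j x) (bs ! j) \<in> span (set (take j bs))"
proof -
  obtain c where c: "bracket x (bs ! j) - scale c (bs ! j) \<in> span (set (take j bs))"
    using bs(2) j unfolding flag_def by blast
  define r where "r = bracket x (bs ! j) - scale c (bs ! j)"
  have b: "bs ! j \<in> span (set bs)" and r: "r \<in> span (set bs)"
    using j c span_mono[OF set_take_subset[of j bs]] by (auto simp: span_base r_def)
  have r0: "representation (set bs) r (bs ! j) = 0"
    using representation_take_eq_0[OF bs(1), of r j j] j c by (simp add: r_def)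
  have "weight bs j x = representation (set bs) (r + scale c (bs ! j)) (bs ! j)"
    by (simp add: weight_def r_def)
  also have "\<dots> = c"
    using ordered_basisD(2)[OF bs(1)] b r r0 representation_nth[OF bs(1) j j]
    by (simp add: representation_add representation_scale span_scale)
  finally show ?thesis using c by simp
qed

lemma lie_ideal_span_take:
  assumes "flag bs"
  shows "lie_ideal (span (set (take j bs)))"
proof -
  have "bracket x y \<in> span (set (take j bs))" if "y \<in> span (set (take j bs))" for x y
  proof (rule span_invariant[OF bracket_linear_right subspace_span _ that])
    fix b assume "b \<in> set (take j bs)"
    then obtain i where i: "i < j" "i < length bs" "b = bs ! i"
      by (auto simp: in_set_conv_nth)
    then obtain c where "bracket x b - scale c b \<in> span (set (take i bs))"
      using assms unfolding flag_def by blast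
    then have "bracket x b - scale c b \<in> span (set (take j bs))"
      using span_take_mono[of i j] i by auto
    moreover have "scale c b \<in> span (set (take j bs))"
      using i by (auto intro: span_scale nth_in_span_take)
    ultimately show "bracket x b \<in> span (set (take j bs))"
      using span_add by fastforce
  qed
  then show ?thesis by (simp add: lie_ideal_def)
qed

text \<open>
  Triangular matrices and flags are the same thing in two languages: matrices are what the
  definitions of the weights and of the characteristic polynomial use, flags are what the arguments
  with ideals use.
\<close>

lemma flag_iff_upper_triangular:
  assumes bs: "ordered_basis bs W" and W: "lie_ideal W"
  shows "flag bs \<longleftrightarrow> (\<forall>x. upper_triangular (matrix_of bs (ad x)))"
proof
  assume fl: "flag bs"
  show "\<forall>x. upper_triangular (matrix_of bs (ad x))"
  proof (intro allI upper_triangularI)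
    fix x i j assume "j < i" "i < dim_row (matrix_of bs (ad x))"
    then have ij: "j < i" "i < length bs" by (simp_all add: matrix_of_def)
    have "bracket x (bs ! j) \<in> span (set (take (Suc j) bs))"
      using lie_ideal_bracket[OF lie_ideal_span_take[OF fl]] nth_in_span_take ij by simp
    then show "matrix_of bs (ad x) $$ (i, j) = 0"
      using representation_take_eq_0[OF bs, of _ "Suc j" i] ij by (simp add: matrix_of_def ad_def)
  qed
next
  assume ut: "\<forall>x. upper_triangular (matrix_of bs (ad x))"
  show "flag bs"
    unfolding flag_def
  proof (intro allI impI)
    fix x j assume j: "j < length bs"
    have bW: "bs ! j \<in> W" using ordered_basisD(3)[OF bs] j span_base by auto
    have brW: "bracket x (bs ! j) \<in> W" using lie_ideal_bracket[OF W bW] .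
    have "bracket x (bs ! j) - scale (weight bs j x) (bs ! j) \<in> span (set (take j bs))"
    proof (rule span_takeI[OF bs])
      show "bracket x (bs ! j) - scale (weight bs j x) (bs ! j) \<in> W"
        using bW brW lie_ideal_subspace[OF W] by (simp add: subspace_diff subspace_scale)
      fix i assume i: "j \<le> i" "i < length bs"
      have "representation (set bs) (bracket x (bs ! j)) (bs ! i) = 0" if "j < i"
        using ut i that by (fastforce simp: upper_triangular_def matrix_of_def ad_def)
      then have "representation (set bs) (bracket x (bs ! j)) (bs ! i)
          - weight bs j x * representation (set bs) (bs ! j) (bs ! i) = 0"
        using i j representation_nth[OF bs j i(2)] by (cases "i = j") (auto simp: weight_def)
      then show "representation (set bs)
          (bracket x (bs ! j) - scale (weight bs j x) (bs ! j)) (bs ! i) = 0"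
        using ordered_basisD(2)[OF bs] bW brW unfolding ordered_basisD(3)[OF bs, symmetric]
        by (simp add: representation_diff representation_scale span_scale)
    qed
    then show "\<exists>c. bracket x (bs ! j) - scale c (bs ! j) \<in> span (set (take j bs))" by blast
  qed
qed

lemma flag_snoc:
  assumes "flag bs" "\<And>x. \<exists>c. bracket x w - scale c w \<in> span (set bs)"
  shows "flag (bs @ [w])"
  unfolding flag_def
proof (intro allI impI)
  fix x j assume "j < length (bs @ [w])"
  then consider "j < length bs" | "j = length bs" by fastforce
  then show "\<exists>c. bracket x ((bs @ [w]) ! j) - scale c ((bs @ [w]) ! j)
      \<in> span (set (take j (bs @ [w])))"
    using assms by cases (auto simp: flag_def nth_append)
qed

text \<open>
  A flag of maximal length in \<open>W\<close> spans \<open>W\<close>, since Lie's theorem would extend it otherwise.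
\<close>

theorem exists_flag_basis:
  assumes "solvable" and W: "lie_ideal W"
  shows "\<exists>bs. ordered_basis bs W \<and> flag bs"
proof -
  define P where "P bs \<longleftrightarrow> distinct bs \<and> independent (set bs) \<and> set bs \<subseteq> W \<and> flag bs" for bs
  obtain S where S: "finite S" "span S = UNIV" using finite_dimensional by blast
  have "P []" by (simp add: P_def independent_empty flag_def)
  moreover have "\<forall>bs. P bs \<longrightarrow> length bs \<le> card S"
    using independent_span_bound[OF S(1)] S(2) by (metis P_def UNIV_I distinct_card subsetI)
  ultimately have "\<exists>bs. P bs \<and> (\<forall>cs. P cs \<longrightarrow> length cs \<le> length bs)"
    by (intro ex_has_greatest_nat[of P _ _ "Suc (card S)"]) (auto simp: less_Suc_eq_le)
  then obtain bs where bs: "P bs" and max: "\<And>cs. P cs \<Longrightarrow> length cs \<le> length bs" by blast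
  have sub: "span (set bs) \<subseteq> W"
    using bs span_minimal[OF _ lie_ideal_subspace[OF W]] by (simp add: P_def)
  have "span (set bs) = W"
  proof (rule ccontr)
    assume "span (set bs) \<noteq> W"
    then obtain w0 where "w0 \<in> W" "w0 \<notin> span (set bs)" using sub by blast
    moreover have "lie_ideal (span (set bs))"
      using lie_ideal_span_take[of bs "length bs"] bs by (simp add: P_def)
    ultimately obtain w where w: "w \<in> W" "w \<notin> span (set bs)"
      "\<And>x. \<exists>c. bracket x w - scale c w \<in> span (set bs)"
      using lie_theorem_mod[OF assms(1) _ W] by blast
    have "w \<notin> set bs" using w(2) span_base by blast
    then have "P (bs @ [w])"
      using bs w flag_snoc[of bs w] by (simp add: P_def independent_insertI)
    then show False using max by fastforce
  qed
  then show ?thesis using bs by (auto simp: P_def ordered_basis_def)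
qed

text \<open>
  On each one-dimensional quotient of the flag the algebra acts by scalars, and these commute.
\<close>

lemma flag_bracket_bracket:
  assumes bs: "ordered_basis bs W" "flag bs" and j: "j < length bs"
  shows "bracket (bracket x y) (bs ! j) \<in> span (set (take j bs))"
proof -
  let ?F = "span (set (take j bs))" and ?b = "bs ! j"
  define r where "r z = bracket z ?b - scale (weight bs j z) ?b" for z
  have r: "r z \<in> ?F" for z unfolding r_def by (rule flag_bracket_weight[OF bs j])
  have br: "bracket z ?b = r z + scale (weight bs j z) ?b" for z by (simp add: r_def)
  have "bracket (bracket x y) ?b = (bracket x (r y) + scale (weight bs j y) (r x))
      - (bracket y (r x) + scale (weight bs j x) (r y))"
    unfolding bracket_bracket_left br[of x] br[of y] bracket_add_right bracket_scale_right
    by (simp add: algebra_simps)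
  moreover have "bracket z (r t) \<in> ?F" for z t
    using lie_ideal_bracket[OF lie_ideal_span_take[OF bs(2)] r] .
  ultimately show ?thesis using r by (simp add: span_add span_diff span_scale)
qed

lemma lower_central_series_subspace:
  assumes "lie_ideal I"
  shows "subspace (lower_central_series I k)"
  using lie_ideal_subspace[OF assms] by (cases k) (simp_all add: bracket_set_def)

text \<open>
  An ideal that lowers every step of the flag has a lower central series that moves down the flag.
\<close>

lemma nilpotent_idealI:
  assumes bs: "ordered_basis bs UNIV" "flag bs" and I: "lie_ideal I"
    and str: "\<And>x j. x \<in> I \<Longrightarrow> j < length bs \<Longrightarrow> bracket x (bs ! j) \<in> span (set (take j bs))"
  shows "nilpotent_ideal I"
proof -
  have lower: "bracket x y \<in> span (set (take (j - 1) bs))"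
    if "x \<in> I" "y \<in> span (set (take j bs))" for x y j
  proof (rule span_invariant[OF bracket_linear_right subspace_span _ that(2)])
    fix b assume "b \<in> set (take j bs)"
    then obtain i where "i < j" "i < length bs" "b = bs ! i" by (auto simp: in_set_conv_nth)
    moreover from this have "i \<le> j - 1" by simp
    ultimately show "bracket x b \<in> span (set (take (j - 1) bs))"
      using str[OF that(1), of i] subsetD[OF span_take_mono] by blast
  qed
  have "lower_central_series I k \<subseteq> span (set (take (length bs - k) bs))" for k
  proof (induction k)
    case 0
    then show ?case using ordered_basisD(3)[OF bs(1)] by simp
  next
    case (Suc k)
    have "{bracket a b |a b. a \<in> I \<and> b \<in> lower_central_series I k}
        \<subseteq> span (set (take (length bs - k - 1) bs))"
    proof clarify
      fix a b assume "a \<in> I" "b \<in> lower_central_series I k"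
      then show "bracket a b \<in> span (set (take (length bs - k - 1) bs))"
        using lower[of a b "length bs - k"] Suc by auto
    qed
    then show ?case using span_minimal[OF _ subspace_span] by (simp add: bracket_set_def)
  qed
  from this[of "length bs"] have "lower_central_series I (length bs) \<subseteq> {0}" by simp
  then have "lower_central_series I (length bs) = {0}"
    using subspace_0[OF lower_central_series_subspace[OF I]] by blast
  then show ?thesis using I by (auto simp: nilpotent_ideal_def)
qed

text \<open>
  If \<open>x\<close> lies in a nilpotent ideal then $(\operatorname{ad} x)^m$ vanishes for large \<open>m\<close>, hence so do
  the \<open>m\<close>-th powers of the weights at \<open>x\<close>.
\<close>

lemma nilpotent_idealD:
  assumes bs: "ordered_basis bs W" "flag bs" and I: "nilpotent_ideal I"
    and x: "x \<in> I" and j: "j < length bs"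
  shows "bracket x (bs ! j) \<in> span (set (take j bs))"
proof -
  let ?F = "span (set (take j bs))" and ?b = "bs ! j"
  obtain k where k: "lower_central_series I k = {0}" and ideal: "lie_ideal I"
    using I by (auto simp: nilpotent_ideal_def)
  define c where "c = weight bs j x"
  have F: "lie_ideal ?F" using lie_ideal_span_take[OF bs(2)] .
  have c: "bracket x ?b - scale c ?b \<in> ?F"
    unfolding c_def by (rule flag_bracket_weight[OF bs j])
  have pow: "(bracket x ^^ m) ?b - scale (c ^ m) ?b \<in> ?F" for m
  proof (induction m)
    case 0
    then show ?case by (simp add: span_zero)
  next
    case (Suc m)
    have "(bracket x ^^ Suc m) ?b - scale (c ^ Suc m) ?b
      = bracket x ((bracket x ^^ m) ?b - scale (c ^ m) ?b)
        + scale (c ^ m) (bracket x ?b - scale c ?b)"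
      by (simp add: bracket_linear_simps algebra_simps)
    then show ?case
      using lie_ideal_bracket[OF F Suc] span_scale[OF c] span_add by simp
  qed
  have "(bracket x ^^ Suc m) ?b \<in> lower_central_series I m" for m
  proof (induction m)
    case 0
    then show ?case using lie_ideal_bracket_left[OF ideal x] by simp
  next
    case (Suc m)
    then show ?case using bracket_in_bracket_set[OF x Suc] by simp
  qed
  from this[of k] have "scale (c ^ Suc k) ?b \<in> ?F"
    using pow[of "Suc k"] k span_neg[of "- scale (c ^ Suc k) ?b" "set (take j bs)"] by simp
  then have "scale (inverse (c ^ Suc k)) (scale (c ^ Suc k) ?b) \<in> ?F" by (rule span_scale)
  then have "c = 0"
    using nth_notin_span_take[OF bs(1) j] by (cases "c = 0") (simp_all del: power_Suc)
  then show ?thesis using c by simp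
qed

text \<open>
  The vectors that lower every step of the flag form an ideal, and by the two preceding lemmas the
  nilpotent ideals are exactly the ideals contained in it. By \<open>flag_bracket_bracket\<close> it contains all
  brackets.
\<close>

lemma
  assumes bs: "ordered_basis bs UNIV" "flag bs"
  shows nilpotent_ideal_nilradical: "nilpotent_ideal nilradical"
    and bracket_in_nilradical: "bracket x y \<in> nilradical"
proof -
  let ?N = "{x. \<forall>j<length bs. bracket x (bs ! j) \<in> span (set (take j bs))}"
  have sub: "subspace ?N"
    by (rule subspaceI)
      (simp_all add: span_zero bracket_add_left span_add bracket_scale_left span_scale)
  have br: "bracket x y \<in> ?N" for x y
    using flag_bracket_bracket[OF bs] by blast
  have ideal: "lie_ideal ?N" using sub br unfolding lie_ideal_def by blast
  have nil: "nilpotent_ideal ?N"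
    by (rule nilpotent_idealI[OF bs ideal]) blast
  \<comment> \<open>\<open>?N\<close> is the largest nilpotent ideal, hence the only maximal one.\<close>
  have max: "I \<subseteq> ?N" if "nilpotent_ideal I" for I
    using nilpotent_idealD[OF bs that] by blast
  have eq: "nilradical = ?N"
    unfolding nilradical_def
  proof (rule the_equality)
    show "nilpotent_ideal ?N \<and> (\<forall>I. nilpotent_ideal I \<and> ?N \<subseteq> I \<longrightarrow> I = ?N)"
      using nil max by blast
  next
    fix M assume M: "nilpotent_ideal M \<and> (\<forall>I. nilpotent_ideal I \<and> M \<subseteq> I \<longrightarrow> I = M)"
    then have "M \<subseteq> ?N" using max by blast
    with nil have "?N = M" using M[THEN conjunct2, THEN spec, of ?N] by (elim mp) (rule conjI)
    then show "M = ?N" by (rule sym)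
  qed
  show "nilpotent_ideal nilradical" using nil unfolding eq .
  show "bracket x y \<in> nilradical" using br unfolding eq .
qed

lemma lie_ideal_nilradical:
  assumes "solvable"
  shows "lie_ideal nilradical"
proof -
  have "lie_ideal UNIV" by (simp add: lie_ideal_def)
  then obtain zs where "ordered_basis zs UNIV" "flag zs"
    using exists_flag_basis[OF assms] by blast
  then show ?thesis
    using nilpotent_ideal_nilradical by (simp add: nilpotent_ideal_def)
qed

lemma triangular_basis:
  assumes "solvable"
  shows "ordered_basis triangular_basis nilradical" "flag triangular_basis"
proof -
  note N = lie_ideal_nilradical[OF assms]
  obtain bs where "ordered_basis bs nilradical" "flag bs"
    using exists_flag_basis[OF assms N] by blast
  then have "\<exists>bs. ordered_basis bs nilradical \<and> (\<forall>y. upper_triangular (matrix_of bs (ad y)))"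
    using flag_iff_upper_triangular[OF _ N] by blast
  from someI_ex[OF this, folded triangular_basis_def]
  show "ordered_basis triangular_basis nilradical" "flag triangular_basis"
    using flag_iff_upper_triangular[OF _ N] by blast+
qed

lemma extend_ordered_basis:
  assumes bs: "ordered_basis bs W"
  shows "\<exists>cs. ordered_basis (bs @ cs) UNIV"
proof -
  obtain S where S: "finite S" "span S = UNIV" using finite_dimensional by blast
  obtain B where B: "set bs \<subseteq> B" "independent B" "UNIV \<subseteq> span B"
    using maximal_independent_subset_extend[OF subset_UNIV ordered_basisD(2)[OF bs]] by metis
  have "finite B" using independent_span_bound[OF S(1) B(2)] S by simp
  then obtain cs where "set cs = B - set bs" "distinct cs"
    using finite_distinct_list by (metis finite_Diff)
  then have "ordered_basis (bs @ cs) UNIV"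
    using B ordered_basisD[OF bs] by (auto simp: ordered_basis_def Un_absorb1)
  then show ?thesis by blast
qed

text \<open>
  Every bracket already lies in the span of \<open>bs\<close>, so the algebra annihilates the added vectors modulo the
  preceding ones.
\<close>

lemma flag_append:
  assumes bs: "ordered_basis bs W" "flag bs" and W: "\<And>x y. bracket x y \<in> W"
  shows "flag (bs @ cs)"
  unfolding flag_def
proof (intro allI impI)
  fix x j assume j: "j < length (bs @ cs)"
  show "\<exists>c. bracket x ((bs @ cs) ! j) - scale c ((bs @ cs) ! j) \<in> span (set (take j (bs @ cs)))"
  proof (cases "j < length bs")
    case True
    then show ?thesis using bs(2) by (simp add: flag_def nth_append)
  next
    case False
    have "span (set bs) \<subseteq> span (set (take j (bs @ cs)))"
      using False by (intro span_mono) auto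
    then have "bracket x ((bs @ cs) ! j) \<in> span (set (take j (bs @ cs)))"
      using W ordered_basisD(3)[OF bs(1)] by blast
    then show ?thesis by (intro exI[of _ 0]) simp
  qed
qed

definition functional :: "('a \<Rightarrow> complex) \<Rightarrow> bool" where
  "functional \<mu> \<longleftrightarrow> (\<forall>x y. \<mu> (x + y) = \<mu> x + \<mu> y) \<and> (\<forall>c x. \<mu> (scale c x) = c * \<mu> x)"

lemma functional_weight:
  assumes bs: "ordered_basis bs W" and W: "lie_ideal W" and j: "j < length bs"
  shows "functional (weight bs j)"
proof -
  have "bracket x (bs ! j) \<in> span (set bs)" for x
    using lie_ideal_bracket[OF W, of "bs ! j" x] ordered_basisD(3)[OF bs] j
      span_base[of "bs ! j" "set bs"] by auto
  then show ?thesis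
    using ordered_basisD[OF bs]
    by (simp add: functional_def weight_def bracket_add_left bracket_scale_left
        representation_add representation_scale)
qed

text \<open>
  Brackets have no component along the added vectors, which therefore contribute zero weights.
\<close>

lemma weight_append:
  assumes bs: "ordered_basis bs W" and W: "\<And>x y. bracket x y \<in> W"
    and ext: "ordered_basis (bs @ cs) UNIV" and j: "j < length (bs @ cs)"
  shows "weight (bs @ cs) j x = (if j < length bs then weight bs j x else 0)"
proof -
  have "representation (set (bs @ cs)) (bracket x ((bs @ cs) ! j))
      = representation (set bs) (bracket x ((bs @ cs) ! j))"
    using ordered_basisD[OF bs] ordered_basisD[OF ext] W by (intro representation_extend) auto
  moreover have "(bs @ cs) ! j \<notin> set bs" if "\<not> j < length bs"
  proof -
    have "(bs @ cs) ! j \<in> set cs" using that j by (simp add: nth_append)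
    then show ?thesis using ordered_basisD(1)[OF ext] by auto
  qed
  ultimately show ?thesis
    using representation_ne_zero[of "set bs"] by (auto simp: weight_def nth_append)
qed

lemma weight_nilradical:
  assumes bs: "ordered_basis bs W" "flag bs" and "nilpotent_ideal nilradical"
    and "x \<in> nilradical" "j < length bs"
  shows "weight bs j x = 0"
  unfolding weight_def
  using representation_take_eq_0[OF bs(1) nilpotent_idealD[OF bs assms(3,4,5)] order_refl assms(5)] .

end

section \<open>Linear equivalence in coordinate space\<close>

interpretation fun_space: vector_space "fscale :: complex \<Rightarrow> ('a \<Rightarrow> complex) \<Rightarrow> _"
  by unfold_locales (auto simp: fscale_def fun_eq_iff algebra_simps)

interpretation fun_space_pair:
  vector_space_pair "fscale :: complex \<Rightarrow> ('a \<Rightarrow> complex) \<Rightarrow> _" "fscale :: complex \<Rightarrow> ('b \<Rightarrow> complex) \<Rightarrow> _" ..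

abbreviation fun_linear :: "(('a \<Rightarrow> complex) \<Rightarrow> ('b \<Rightarrow> complex)) \<Rightarrow> bool" where
  "fun_linear \<equiv> Vector_Spaces.linear fscale fscale"

lemma fun_linear_iff:
  "fun_linear T \<longleftrightarrow> (\<forall>x y. T (x + y) = T x + T y) \<and> (\<forall>c x. T (fscale c x) = fscale c (T x))"
  by (simp add: Vector_Spaces.linear_iff fun_space.vector_space_axioms)

lemma linearly_equivalent_image:
  assumes T: "fun_linear T" and inj: "inj_on T (fun_space.span (set_mset E))"
  shows "linearly_equivalent fscale E fscale (image_mset T E)"
proof -
  interpret T: Vector_Spaces.linear fscale fscale T by fact
  have "bij_betw T (fun_space.span (set_mset E)) (fun_space.span (set_mset (image_mset T E)))"
    using inj T.span_image[of "set_mset E"] by (simp add: bij_betw_def)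
  then show ?thesis
    unfolding linearly_equivalent_def using T.add T.scale by blast
qed

lemma linearly_equivalent_sym:
  fixes E :: "('a \<Rightarrow> complex) multiset" and E' :: "('b \<Rightarrow> complex) multiset"
  assumes "linearly_equivalent fscale E fscale E'"
  shows "linearly_equivalent fscale E' fscale E"
proof -
  let ?S = "fun_space.span (set_mset E)" and ?S' = "fun_space.span (set_mset E')"
  obtain T where bij: "bij_betw T ?S ?S'"
    and add: "\<And>x y. x \<in> ?S \<Longrightarrow> y \<in> ?S \<Longrightarrow> T (x + y) = T x + T y"
    and scale: "\<And>c x. x \<in> ?S \<Longrightarrow> T (fscale c x) = fscale c (T x)"
    and img: "image_mset T E = E'"
    using assms unfolding linearly_equivalent_def by blast
  define R where "R = inv_into ?S T"
  have R: "R y \<in> ?S" "T (R y) = y" if "y \<in> ?S'" for y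
    using that bij by (auto simp: R_def bij_betw_def inv_into_into f_inv_into_f)
  have RT: "R (T x) = x" if "x \<in> ?S" for x
    using that bij by (simp add: R_def bij_betw_def inv_into_f_f)
  have "bij_betw R ?S' ?S" unfolding R_def using bij by (rule bij_betw_inv_into)
  moreover have "R (x + y) = R x + R y" if "x \<in> ?S'" "y \<in> ?S'" for x y
    using RT[of "R x + R y"] add[of "R x" "R y"] R that by (simp add: fun_space.span_add)
  moreover have "R (fscale c x) = fscale c (R x)" if "x \<in> ?S'" for c x
    using RT[of "fscale c (R x)"] scale[of "R x" c] R that by (simp add: fun_space.span_scale)
  moreover have "image_mset R E' = E"
  proof -
    have "image_mset R E' = image_mset (R \<circ> T) E" by (simp add: img[symmetric] image_mset.compositionality)
    also have "\<dots> = image_mset id E"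
      by (rule image_mset_cong) (simp add: RT fun_space.span_base)
    finally show ?thesis by simp
  qed
  ultimately show ?thesis unfolding linearly_equivalent_def by blast
qed

lemma linearly_equivalent_trans:
  fixes E :: "('a \<Rightarrow> complex) multiset" and E' :: "('b \<Rightarrow> complex) multiset"
    and E'' :: "('c \<Rightarrow> complex) multiset"
  assumes "linearly_equivalent fscale E fscale E'" "linearly_equivalent fscale E' fscale E''"
  shows "linearly_equivalent fscale E fscale E''"
proof -
  let ?S = "fun_space.span (set_mset E)" and ?S' = "fun_space.span (set_mset E')"
    and ?S'' = "fun_space.span (set_mset E'')"
  obtain T where T: "bij_betw T ?S ?S'"
    and addT: "\<And>x y. x \<in> ?S \<Longrightarrow> y \<in> ?S \<Longrightarrow> T (x + y) = T x + T y"
    and scaleT: "\<And>c x. x \<in> ?S \<Longrightarrow> T (fscale c x) = fscale c (T x)"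
    and imgT: "image_mset T E = E'"
    using assms(1) unfolding linearly_equivalent_def by blast
  obtain R where R: "bij_betw R ?S' ?S''"
    and addR: "\<And>x y. x \<in> ?S' \<Longrightarrow> y \<in> ?S' \<Longrightarrow> R (x + y) = R x + R y"
    and scaleR: "\<And>c x. x \<in> ?S' \<Longrightarrow> R (fscale c x) = fscale c (R x)"
    and imgR: "image_mset R E' = E''"
    using assms(2) unfolding linearly_equivalent_def by blast
  have T_in: "T x \<in> ?S'" if "x \<in> ?S" for x using T that by (auto simp: bij_betw_def)
  have "bij_betw (R \<circ> T) ?S ?S''" using T R by (rule bij_betw_trans)
  moreover have "image_mset (R \<circ> T) E = E''"
    using imgT imgR by (simp add: image_mset.compositionality[symmetric])
  ultimately show ?thesis
    unfolding linearly_equivalent_def using addT addR scaleT scaleR T_in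
    by (intro exI[of _ "R \<circ> T"]) simp
qed

lemma linearly_equivalent_size:
  "linearly_equivalent sc E sc' E' \<Longrightarrow> size E = size E'"
  unfolding linearly_equivalent_def by auto

lemma subspace_coord_space: "fun_space.subspace (coord_space n)"
  by (rule fun_space.subspaceI) (auto simp: coord_space_def fscale_def)

definition unit_coord :: "nat \<Rightarrow> nat \<Rightarrow> complex" where
  "unit_coord i k = (if k = i then 1 else 0)"

lemma unit_coord_in: "i < n \<Longrightarrow> unit_coord i \<in> coord_space n"
  by (simp add: unit_coord_def coord_space_def)

lemma sum_fun_apply: "(\<Sum>x\<in>A. f x) i = (\<Sum>x\<in>A. f x i)"
  by (induction A rule: infinite_finite_induct) simp_all

lemma coord_expansion:
  assumes "c \<in> coord_space n"
  shows "c = (\<Sum>j<n. fscale (c j) (unit_coord j))"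
proof
  fix i
  have "(\<Sum>j<n. c j * (if i = j then 1 else 0)) = (\<Sum>j<n. if i = j then c j else 0)"
    by (rule sum.cong) auto
  then show "c i = (\<Sum>j<n. fscale (c j) (unit_coord j)) i"
    using assms by (simp add: sum_fun_apply fscale_def unit_coord_def coord_space_def)
qed

lemma linear_eq_mat_act:
  assumes F: "fun_linear F" and into: "\<And>c. c \<in> coord_space n \<Longrightarrow> F c \<in> coord_space n"
    and c: "c \<in> coord_space n"
  shows "F c = mat_act n (mat n n (\<lambda>(i, j). F (unit_coord j) i)) c"
proof
  interpret F: Vector_Spaces.linear fscale fscale F by fact
  fix i
  have "F c = (\<Sum>j<n. fscale (c j) (F (unit_coord j)))"
    using arg_cong[OF coord_expansion[OF c], of F] by (simp only: F.sum F.scale)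
  then have "F c i = (\<Sum>j<n. c j * F (unit_coord j) i)"
    by (simp add: sum_fun_apply fscale_def)
  moreover have "i \<ge> n \<Longrightarrow> F c i = 0" using into[OF c] by (simp add: coord_space_def)
  ultimately show "F c i = mat_act n (mat n n (\<lambda>(i, j). F (unit_coord j) i)) c i"
    by (auto simp: mat_act_def mult.commute)
qed

lemma linear_mat_act: "fun_linear (mat_act n B)"
  unfolding fun_linear_iff
  by (auto simp: mat_act_def fun_eq_iff fscale_def sum.distrib sum_distrib_left algebra_simps)

lemma inj_on_mat_act:
  assumes B: "B \<in> carrier_mat n n" and "invertible_mat B"
  shows "inj_on (mat_act n B) (coord_space n)"
proof -
  obtain B' where B': "B * B' = 1\<^sub>m n" "B' * B = 1\<^sub>m (dim_row B')"
    using assms unfolding invertible_mat_def inverts_mat_def by auto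
  have "dim_col B' = n" using arg_cong[OF B'(1), of dim_col] by simp
  moreover have "dim_row B' = n" using arg_cong[OF B'(2), of dim_col] B by simp
  ultimately have "B' \<in> carrier_mat n n" by blast
  then show ?thesis
    using mat_act_mult[of B' n B] B B' mat_act_one
    by (intro inj_on_inverseI[of _ "mat_act n B'"]) simp
qed

lemma mat_of_inverse_maps:
  assumes F: "fun_linear F" "\<And>c. c \<in> coord_space n \<Longrightarrow> F c \<in> coord_space n"
    and G: "fun_linear G" "\<And>c. c \<in> coord_space n \<Longrightarrow> G c \<in> coord_space n"
    and FG: "\<And>c. c \<in> coord_space n \<Longrightarrow> F (G c) = c"
  shows "mat n n (\<lambda>(i, j). F (unit_coord j) i) * mat n n (\<lambda>(i, j). G (unit_coord j) i) = 1\<^sub>m n"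
proof (rule eq_matI)
  fix i j assume "i < dim_row (1\<^sub>m n :: complex mat)" "j < dim_col (1\<^sub>m n :: complex mat)"
  then have ij: "i < n" "j < n" by simp_all
  have "unit_coord j i = F (G (unit_coord j)) i" using FG unit_coord_in ij by simp
  also have "\<dots> = (\<Sum>k<n. F (unit_coord k) i * G (unit_coord j) k)"
    using ij by (subst linear_eq_mat_act[OF F G(2)[OF unit_coord_in]]) (auto simp: mat_act_def)
  finally show "(mat n n (\<lambda>(i, j). F (unit_coord j) i) * mat n n (\<lambda>(i, j). G (unit_coord j) i)) $$ (i, j)
      = 1\<^sub>m n $$ (i, j)"
    using ij by (simp add: scalar_prod_def atLeast0LessThan unit_coord_def)
qed simp_all

lemma coord_basis_card:
  assumes "fun_space.independent B" "B \<subseteq> coord_space n" "coord_space n \<subseteq> fun_space.span B"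
  shows "finite B \<and> card B = fun_space.dim (coord_space n)"
proof -
  have "c \<in> fun_space.span (unit_coord ` {..<n})" if "c \<in> coord_space n" for c
    by (subst coord_expansion[OF that])
      (intro fun_space.span_sum fun_space.span_scale fun_space.span_base imageI)
  then have "B \<subseteq> fun_space.span (unit_coord ` {..<n})" using assms(2) by blast
  then have "finite B"
    using fun_space.independent_span_bound[of "unit_coord ` {..<n}" B] assms(1) by simp
  then show ?thesis using fun_space.basis_card_eq_dim[OF assms(2,3,1)] by simp
qed

text \<open>
  Bases of the two spans that correspond under \<open>T\<close> are extended to bases of $\mathbb{C}^n$. The added
  parts have the same cardinality, so any bijection between them defines the extension.
\<close>

lemma extend_to_coord_automorphism:
  assumes A: "A \<subseteq> coord_space n" and A': "A' \<subseteq> coord_space n"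
    and T: "bij_betw T (fun_space.span A) (fun_space.span A')"
    and add: "\<And>x y. x \<in> fun_space.span A \<Longrightarrow> y \<in> fun_space.span A \<Longrightarrow> T (x + y) = T x + T y"
    and scale: "\<And>c x. x \<in> fun_space.span A \<Longrightarrow> T (fscale c x) = fscale c (T x)"
  shows "\<exists>B \<in> carrier_mat n n. invertible_mat B \<and> (\<forall>x\<in>A. mat_act n B x = T x)"
proof -
  obtain b where b: "b \<subseteq> A" "fun_space.independent b" "A \<subseteq> fun_space.span b"
    using fun_space.maximal_independent_subset by blast
  have span_b: "fun_space.span b = fun_space.span A"
    using b fun_space.span_eq fun_space.span_superset[of A] by blast
  obtain F0 where F0: "fun_linear F0" "\<forall>x\<in>b. F0 x = T x"
    using fun_space_pair.linear_independent_extend[OF b(2), of T] by blast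
  interpret F0: Vector_Spaces.linear fscale fscale F0 by (rule F0(1))
  have T0: "T 0 = 0"
    using scale[of 0 0] by (simp add: fun_space.span_zero)
  have "x \<in> fun_space.span A \<and> F0 x = T x" if "x \<in> fun_space.span b" for x
    using that
  proof (induction rule: fun_space.span_induct_alt)
    case base
    show ?case by (simp only: T0 F0.zero fun_space.span_zero simp_thms)
  next
    case (step c x y)
    have "x \<in> fun_space.span A"
      using step b(1) fun_space.span_base by auto
    then have "T (fscale c x + y) = fscale c (T x) + T y"
      using step.IH by (simp only: add scale fun_space.span_scale)
    moreover have "F0 (fscale c x + y) = fscale c (F0 x) + F0 y"
      by (simp only: F0.add F0.scale)
    ultimately show ?case
      using step F0(2) \<open>x \<in> fun_space.span A\<close>
      by (simp only: fun_space.span_scale fun_space.span_add simp_thms)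
  qed
  then have F0_T: "F0 x = T x" if "x \<in> fun_space.span b" for x using that by blast
  have injT: "inj_on F0 (fun_space.span b)"
    using T F0_T span_b by (auto simp: bij_betw_def inj_on_def)
  have Tb: "T ` b = F0 ` b" using F0(2) by auto
  have indT: "fun_space.independent (T ` b)"
    unfolding Tb by (rule F0.independent_injective_image[OF b(2) injT])
  have "T ` b \<subseteq> fun_space.span A'"
    using T span_b fun_space.span_superset[of b] by (auto simp: bij_betw_def)
  then have TbC: "T ` b \<subseteq> coord_space n"
    using fun_space.span_minimal[OF A' subspace_coord_space] by blast
  have bC: "b \<subseteq> coord_space n" using b A by blast
  obtain B1 where B1: "b \<subseteq> B1" "B1 \<subseteq> coord_space n" "fun_space.independent B1"
    "coord_space n \<subseteq> fun_space.span B1"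
    by (rule fun_space.maximal_independent_subset_extend[OF bC b(2)])
  obtain B2 where B2: "T ` b \<subseteq> B2" "B2 \<subseteq> coord_space n" "fun_space.independent B2"
    "coord_space n \<subseteq> fun_space.span B2"
    by (rule fun_space.maximal_independent_subset_extend[OF TbC indT])
  note card1 = coord_basis_card[OF B1(3,2,4)] and card2 = coord_basis_card[OF B2(3,2,4)]
  have inj_b: "inj_on T b"
    using injT F0(2) fun_space.span_superset[of b] by (auto simp: inj_on_def subset_iff)
  have "card (B1 - b) = card (B2 - T ` b)"
    using card1 card2 B1(1) B2(1) card_image[OF inj_b]
    by (simp add: card_Diff_subset finite_subset)
  then obtain h where h: "bij_betw h (B1 - b) (B2 - T ` b)"
    using card1 card2 finite_same_card_bij by blast
  define g where "g x = (if x \<in> b then T x else h x)" for x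
  have "bij_betw g (b \<union> (B1 - b)) (T ` b \<union> (B2 - T ` b))"
  proof (rule bij_betw_combine)
    show "bij_betw g b (T ` b)"
      using inj_on_imp_bij_betw[OF inj_b] by (rule iffD1[OF bij_betw_cong, rotated]) (simp add: g_def)
    show "bij_betw g (B1 - b) (B2 - T ` b)"
      using h by (rule iffD1[OF bij_betw_cong, rotated]) (simp add: g_def)
  qed blast
  then have g: "bij_betw g B1 B2" using B1(1) B2(1) by (simp add: Un_absorb1)
  obtain F where F: "fun_linear F" "\<forall>x\<in>B1. F x = g x"
    using fun_space_pair.linear_independent_extend[OF B1(3), of g] by blast
  obtain G where G: "fun_linear G" "\<forall>x\<in>B2. G x = inv_into B1 g x"
    using fun_space_pair.linear_independent_extend[OF B2(3), of "inv_into B1 g"] by blast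
  interpret F: Vector_Spaces.linear fscale fscale F by (rule F(1))
  interpret G: Vector_Spaces.linear fscale fscale G by (rule G(1))
  have span1: "fun_space.span B1 = coord_space n" and span2: "fun_space.span B2 = coord_space n"
    using fun_space.span_minimal[OF _ subspace_coord_space] B1 B2 by blast+
  have "F ` B1 = B2" "G ` B2 = B1"
    using F(2) G(2) g bij_betw_inv_into[OF g] by (auto simp: bij_betw_def)
  then have F_into: "F c \<in> coord_space n" and G_into: "G c \<in> coord_space n"
    if "c \<in> coord_space n" for c
    using that F.span_image[of B1] G.span_image[of B2] span1 span2 by auto
  have FG: "F (G c) = c" if "c \<in> coord_space n" for c
  proof -
    have "(F \<circ> G) c = id c"
    proof (rule fun_space_pair.linear_eq_on[of "F \<circ> G" id])
      show "fun_linear (F \<circ> G)" using F.add G.add F.scale G.scale by (simp add: fun_linear_iff)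
      show "fun_linear (id :: (nat \<Rightarrow> complex) \<Rightarrow> _)" by (simp add: fun_linear_iff)
      show "c \<in> fun_space.span B2" using that span2 by simp
      show "(F \<circ> G) x = id x" if "x \<in> B2" for x
        using that F(2) G(2) g
        by (simp add: bij_betw_def f_inv_into_f inv_into_into)
    qed
    then show ?thesis by simp
  qed
  have GF: "G (F c) = c" if "c \<in> coord_space n" for c
  proof -
    have "(G \<circ> F) c = id c"
    proof (rule fun_space_pair.linear_eq_on[of "G \<circ> F" id])
      show "fun_linear (G \<circ> F)" using F.add G.add F.scale G.scale by (simp add: fun_linear_iff)
      show "fun_linear (id :: (nat \<Rightarrow> complex) \<Rightarrow> _)" by (simp add: fun_linear_iff)
      show "c \<in> fun_space.span B1" using that span1 by simp
      show "(G \<circ> F) x = id x" if "x \<in> B1" for x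
        using that F(2) G(2) g by (auto simp: bij_betw_def inv_into_f_f)
    qed
    then show ?thesis by simp
  qed
  define M where "M = mat n n (\<lambda>(i, j). F (unit_coord j) i)"
  define M' where "M' = mat n n (\<lambda>(i, j). G (unit_coord j) i)"
  have "M * M' = 1\<^sub>m n" "M' * M = 1\<^sub>m n"
    unfolding M_def M'_def
    using mat_of_inverse_maps[OF F(1) F_into G(1) G_into FG]
      mat_of_inverse_maps[OF G(1) G_into F(1) F_into GF] by simp_all
  then have "invertible_mat M"
    unfolding invertible_mat_def inverts_mat_def by (auto simp: M_def M'_def intro!: exI[of _ M'])
  moreover have "mat_act n M x = T x" if "x \<in> A" for x
  proof -
    have "x \<in> fun_space.span b" using b that by blast
    have "F x = F0 x"
    proof (rule fun_space_pair.linear_eq_on[OF F(1) F0(1) \<open>x \<in> fun_space.span b\<close>])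
      fix y assume "y \<in> b"
      then show "F y = F0 y" using F(2) F0(2) B1(1) by (auto simp: g_def)
    qed
    then show ?thesis
      using linear_eq_mat_act[OF F(1) F_into, of x] F0_T[OF \<open>x \<in> fun_space.span b\<close>] A that
      by (auto simp: M_def)
  qed
  moreover have "M \<in> carrier_mat n n" by (simp add: M_def)
  ultimately show ?thesis by blast
qed

text \<open>
  An isomorphism between the spans extends to an automorphism of $\mathbb{C}^n$, and conversely an
  invertible matrix restricts to an isomorphism of the spans.
\<close>

lemma linearly_equivalent_coord_iff:
  assumes E: "set_mset E \<subseteq> coord_space n" and E': "set_mset E' \<subseteq> coord_space n"
  shows "linearly_equivalent fscale E fscale E' \<longleftrightarrow>
    (\<exists>B \<in> carrier_mat n n. invertible_mat B \<and> image_mset (mat_act n B) E = E')"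
proof
  assume "linearly_equivalent fscale E fscale E'"
  then obtain T where T: "bij_betw T (fun_space.span (set_mset E)) (fun_space.span (set_mset E'))"
    "\<And>x y. x \<in> fun_space.span (set_mset E) \<Longrightarrow> y \<in> fun_space.span (set_mset E) \<Longrightarrow> T (x + y) = T x + T y"
    "\<And>c x. x \<in> fun_space.span (set_mset E) \<Longrightarrow> T (fscale c x) = fscale c (T x)"
    "image_mset T E = E'"
    unfolding linearly_equivalent_def by blast
  obtain B where "B \<in> carrier_mat n n" "invertible_mat B" "\<And>x. x \<in># E \<Longrightarrow> mat_act n B x = T x"
    using extend_to_coord_automorphism[OF E E' T(1-3)] by blast
  moreover from this(3) have "image_mset (mat_act n B) E = E'"
    using T(4) image_mset_cong by blast
  ultimately show "\<exists>B \<in> carrier_mat n n. invertible_mat B \<and> image_mset (mat_act n B) E = E'" by blast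
next
  assume "\<exists>B \<in> carrier_mat n n. invertible_mat B \<and> image_mset (mat_act n B) E = E'"
  then obtain B where B: "B \<in> carrier_mat n n" "invertible_mat B" "image_mset (mat_act n B) E = E'"
    by blast
  have "inj_on (mat_act n B) (fun_space.span (set_mset E))"
    by (rule inj_on_subset[OF inj_on_mat_act[OF B(1,2)] fun_space.span_minimal[OF E subspace_coord_space]])
  then show "linearly_equivalent fscale E fscale E'"
    using linearly_equivalent_image[OF linear_mat_act] B(3) by blast
qed

section \<open>The characteristic polynomial and the weights\<close>

text \<open>
  The matrix whose determinant is the characteristic polynomial, for an arbitrary family of matrices,
  so that it can be compared for two bases of the algebra while the variables stay attached to one.
\<close>

definition pencil :: "nat \<Rightarrow> (nat \<Rightarrow> complex mat) \<Rightarrow> cpoly mat" where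
  "pencil n A = Var 0 \<cdot>\<^sub>m 1\<^sub>m n +
     mat n n (\<lambda>(a, b). \<Sum>i<n. Var (Suc i) * Const (A i $$ (a, b)))"

interpretation Const: comm_ring_hom Const
  by unfold_locales (simp_all add: Const_add Const_mult)

lemma pencil_entry:
  "a < n \<Longrightarrow> b < n \<Longrightarrow> pencil n A $$ (a, b)
    = (if a = b then Var 0 else 0) + (\<Sum>i<n. Var (Suc i) * Const (A i $$ (a, b)))"
  by (simp add: pencil_def)

lemma pencil_carrier [simp]: "pencil n A \<in> carrier_mat n n"
  by (simp add: pencil_def)

lemma pencil_dim [simp]: "dim_row (pencil n A) = n" "dim_col (pencil n A) = n"
  by (simp_all add: pencil_def)

text \<open>
  The relations between the matrices pass to the pencils because \<open>P\<close> has constant entries. Its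
  determinant is then a nonzero constant, which cancels.
\<close>

lemma det_pencil_similar:
  assumes A: "\<And>i. i < n \<Longrightarrow> A i \<in> carrier_mat n n" and T: "\<And>i. i < n \<Longrightarrow> T i \<in> carrier_mat n n"
    and P: "P \<in> carrier_mat n n" "P' \<in> carrier_mat n n" "P * P' = 1\<^sub>m n"
    and conj: "\<And>i. i < n \<Longrightarrow> A i * P = P * T i"
  shows "det (pencil n A) = det (pencil n T)"
proof -
  let ?C = "map_mat Const P"
  have entry: "(M * N) $$ (a, b) = (\<Sum>k<n. M $$ (a, k) * N $$ (k, b))"
    if "M \<in> carrier_mat n n" "N \<in> carrier_mat n n" "a < n" "b < n"
    for a b and M N :: "'b::comm_ring_1 mat"
    using that by (simp add: scalar_prod_def atLeast0LessThan)
  have C: "?C \<in> carrier_mat n n" using P by simp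
  have "pencil n A * ?C = ?C * pencil n T"
  proof (rule eq_matI)
    fix a b assume "a < dim_row (?C * pencil n T)" "b < dim_col (?C * pencil n T)"
    then have ab: "a < n" "b < n" using C pencil_carrier[of n T] by auto
    have "(pencil n A * ?C) $$ (a, b) = (\<Sum>k<n. pencil n A $$ (a, k) * Const (P $$ (k, b)))"
      using P ab by (subst entry[OF pencil_carrier C ab]) (auto intro!: sum.cong)
    also have "\<dots> = (\<Sum>k<n. (if a = k then Var 0 * Const (P $$ (k, b)) else 0))
        + (\<Sum>k<n. \<Sum>i<n. Var (Suc i) * Const (A i $$ (a, k) * P $$ (k, b)))"
      unfolding sum.distrib[symmetric] using ab
      by (intro sum.cong refl) (simp add: pencil_entry distrib_right sum_distrib_right Const_mult mult.assoc)
    also have "(\<Sum>k<n. \<Sum>i<n. Var (Suc i) * Const (A i $$ (a, k) * P $$ (k, b)))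
        = (\<Sum>i<n. Var (Suc i) * Const ((A i * P) $$ (a, b)))"
      using ab A P(1)
      by (subst sum.swap) (intro sum.cong refl, simp only: lessThan_iff entry Const_sum sum_distrib_left)
    also have "\<dots> = (\<Sum>i<n. Var (Suc i) * Const ((P * T i) $$ (a, b)))"
      using conj by (intro sum.cong refl) simp
    also have "\<dots> = (\<Sum>k<n. \<Sum>i<n. Var (Suc i) * Const (P $$ (a, k) * T i $$ (k, b)))"
      using ab T P(1)
      by (subst sum.swap) (intro sum.cong refl, simp only: lessThan_iff entry Const_sum sum_distrib_left)
    also have "(\<Sum>k<n. (if a = k then Var 0 * Const (P $$ (k, b)) else 0))
        = (\<Sum>k<n. (if k = b then Var 0 * Const (P $$ (a, k)) else 0))"
      using ab by simp
    also have "\<dots> + (\<Sum>k<n. \<Sum>i<n. Var (Suc i) * Const (P $$ (a, k) * T i $$ (k, b)))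
        = (\<Sum>k<n. Const (P $$ (a, k)) * pencil n T $$ (k, b))"
      unfolding sum.distrib[symmetric] using ab
      by (intro sum.cong refl)
        (simp add: pencil_entry distrib_left sum_distrib_left Const_mult mult.left_commute mult.commute)
    also have "\<dots> = (?C * pencil n T) $$ (a, b)"
      using P ab by (subst entry[OF C pencil_carrier ab]) (auto intro!: sum.cong)
    finally show "(pencil n A * ?C) $$ (a, b) = (?C * pencil n T) $$ (a, b)" .
  qed (use P in simp_all)
  then have "det (pencil n A) * det ?C = det ?C * det (pencil n T)"
    using det_mult[OF pencil_carrier C] det_mult[OF C pencil_carrier] by metis
  moreover have "det ?C \<noteq> 0"
  proof -
    have "det P * det P' = 1" using det_mult[OF P(1,2)] P(3) by simp
    then have "Const (det P) * Const (det P') = 1" by (simp flip: Const_mult)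
    then show ?thesis by auto
  qed
  ultimately show ?thesis by (simp add: mult.commute)
qed

lemma det_pencil_upper_triangular:
  assumes "\<And>i. i < n \<Longrightarrow> T i \<in> carrier_mat n n" "\<And>i. i < n \<Longrightarrow> upper_triangular (T i)"
  shows "det (pencil n T) = (\<Prod>a<n. linear_form n (\<lambda>i. T i $$ (a, a)))"
proof -
  have "upper_triangular (pencil n T)"
  proof (rule upper_triangularI)
    fix a b assume "b < a" "a < dim_row (pencil n T)"
    then have ab: "b < a" "a < n" by simp_all
    have "T i $$ (a, b) = 0" if "i < n" for i
      using upper_triangularD[OF assms(2)[OF that] ab(1)] assms(1)[OF that] ab(2) by auto
    then show "pencil n T $$ (a, b) = 0" using ab by (simp add: pencil_entry)
  qed
  then have "det (pencil n T) = (\<Prod>a<n. pencil n T $$ (a, a))"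
    by (subst det_upper_triangular[OF _ pencil_carrier])
      (simp_all add: prod_list_diag_prod atLeast0LessThan)
  then show ?thesis by (simp add: pencil_entry linear_form_def)
qed

context complex_lie_algebra
begin

lemma representation_sum_scale:
  assumes "ordered_basis xs UNIV"
  shows "representation (set xs) (\<Sum>k\<in>K. scale (c k) (w k)) b = (\<Sum>k\<in>K. c k * representation (set xs) (w k) b)"
  using ordered_basisD[OF assms]
  by (simp add: representation_sum representation_scale span_scale)

lemma length_ordered_basis:
  assumes "ordered_basis xs UNIV" "ordered_basis zs UNIV"
  shows "length xs = length zs"
proof -
  note x = ordered_basisD[OF assms(1)] and z = ordered_basisD[OF assms(2)]
  have "card (set xs) \<le> card (set zs)" "card (set zs) \<le> card (set xs)"
    using independent_span_bound[of "set zs" "set xs"] independent_span_bound[of "set xs" "set zs"] x z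
    by simp_all
  then show ?thesis using x(1) z(1) by (simp add: distinct_card)
qed

definition coords :: "'a list \<Rightarrow> ('a \<Rightarrow> complex) \<Rightarrow> nat \<Rightarrow> complex" where
  "coords xs \<mu> i = (if i < length xs then \<mu> (xs ! i) else 0)"

text \<open>
  The adjoint matrices in the basis \<open>xs\<close> are simultaneously conjugate to those in the flag basis \<open>zs\<close>,
  which are triangular. Only the matrices change basis: the variables remain those of \<open>xs\<close>, hence the
  coordinates of the weights with respect to \<open>xs\<close>.
\<close>

theorem char_polynomial_eq_prod:
  assumes xs: "ordered_basis xs UNIV" and zs: "ordered_basis zs UNIV" "flag zs"
  shows "char_polynomial xs = (\<Prod>a<length zs. linear_form (length xs) (coords xs (weight zs a)))"
proof -
  define n where "n = length xs"
  have len: "length zs = n" using length_ordered_basis[OF xs zs(1)] by (simp add: n_def)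
  define basis_change where "basis_change us vs = mat n n
    (\<lambda>(i, j). representation (set us) (vs ! j) (us ! i))" for us vs :: "'a list"
  let ?P = "basis_change xs zs" and ?P' = "basis_change zs xs"
  let ?A = "\<lambda>i. matrix_of xs (ad (xs ! i))" and ?T = "\<lambda>i. matrix_of zs (ad (xs ! i))"
  have coord_change: "(\<Sum>k<n. representation (set xs) (zs ! k) b * representation (set zs) v (zs ! k))
      = representation (set xs) v b" for v b
    using arg_cong[OF ordered_basis_expansion[OF zs(1) UNIV_I, of v], of "\<lambda>v. representation (set xs) v b"]
    unfolding representation_sum_scale[OF xs] len by (simp add: mult.commute)
  have "?P * ?P' = 1\<^sub>m n"
  proof (rule eq_matI)
    fix i j assume "i < dim_row (1\<^sub>m n :: complex mat)" "j < dim_col (1\<^sub>m n :: complex mat)"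
    then show "(?P * ?P') $$ (i, j) = 1\<^sub>m n $$ (i, j)"
      using coord_change[of "xs ! i" "xs ! j"] representation_nth[OF xs, of j i]
      by (simp add: basis_change_def scalar_prod_def atLeast0LessThan n_def)
  qed (simp_all add: basis_change_def)
  moreover have "?A i * ?P = ?P * ?T i" for i
  proof (rule eq_matI)
    fix a b assume "a < dim_row (?P * ?T i)" "b < dim_col (?P * ?T i)"
    then have ab: "a < n" "b < n" by (simp_all add: basis_change_def matrix_of_def len)
    interpret ad: Vector_Spaces.linear scale scale "bracket (xs ! i)" by (rule bracket_linear_right)
    have "(\<Sum>k<n. scale (representation (set xs) (zs ! b) (xs ! k)) (bracket (xs ! i) (xs ! k)))
        = bracket (xs ! i) (zs ! b)"
      using arg_cong[OF ordered_basis_expansion[OF xs UNIV_I, of "zs ! b"], of "bracket (xs ! i)"]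
      unfolding ad.sum ad.scale n_def .
    from arg_cong[OF this, of "\<lambda>v. representation (set xs) v (xs ! a)"]
    have "(?A i * ?P) $$ (a, b) = representation (set xs) (bracket (xs ! i) (zs ! b)) (xs ! a)"
      unfolding representation_sum_scale[OF xs] using ab
      by (simp add: basis_change_def matrix_of_def ad_def scalar_prod_def atLeast0LessThan
          flip: n_def) (simp add: mult.commute)
    also have "\<dots> = (?P * ?T i) $$ (a, b)"
      using coord_change[of "xs ! a" "bracket (xs ! i) (zs ! b)"] ab
      by (simp add: basis_change_def matrix_of_def ad_def scalar_prod_def atLeast0LessThan len)
    finally show "(?A i * ?P) $$ (a, b) = (?P * ?T i) $$ (a, b)" .
  qed (simp_all add: basis_change_def matrix_of_def len flip: n_def)
  moreover have "?A i \<in> carrier_mat n n" "?T i \<in> carrier_mat n n" for i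
    by (simp_all add: matrix_of_def len flip: n_def)
  ultimately have "det (pencil n ?A) = det (pencil n ?T)"
    by (intro det_pencil_similar[of n ?A ?T ?P ?P']) (simp_all add: basis_change_def)
  also have "\<dots> = (\<Prod>a<n. linear_form n (\<lambda>i. ?T i $$ (a, a)))"
  proof (rule det_pencil_upper_triangular)
    show "upper_triangular (?T i)" for i
      using flag_iff_upper_triangular[OF zs(1)] zs(2) by (simp add: lie_ideal_def)
  qed (simp add: matrix_of_def len)
  also have "\<dots> = (\<Prod>a<n. linear_form n (coords xs (weight zs a)))"
    by (intro prod.cong refl) (simp add: linear_form_def coords_def matrix_of_ad_diagonal len flip: n_def)
  finally show ?thesis by (simp add: char_polynomial_def pencil_def len flip: n_def)
qed

lemma functional_sum:
  assumes "functional \<mu>"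
  shows "\<mu> (\<Sum>i\<in>A. scale (c i) (w i)) = (\<Sum>i\<in>A. c i * \<mu> (w i))"
proof -
  have "\<mu> 0 = 0" using assms unfolding functional_def by (metis mult_zero_left scale_zero_left)
  then show ?thesis
    using assms by (induction A rule: infinite_finite_induct) (simp_all add: functional_def)
qed

lemma functional_eq_0:
  assumes "functional \<mu>" and xs: "ordered_basis xs UNIV" and "coords xs \<mu> = 0"
  shows "\<mu> x = 0"
proof -
  have "\<mu> (xs ! i) = 0" if "i < length xs" for i
    using fun_cong[OF assms(3), of i] that by (simp add: coords_def)
  then show ?thesis
    using functional_sum[OF assms(1), of "\<lambda>i. representation (set xs) x (xs ! i)" "(!) xs" "{..<length xs}"]
    by (simp add: ordered_basis_expansion[OF xs UNIV_I])
qed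

text \<open>
  Functions on \<open>V\<close> are represented by functions that are zero outside \<open>V\<close>, so this is restriction to
  \<open>V\<close>.
\<close>

definition cut :: "'a set \<Rightarrow> ('a \<Rightarrow> complex) \<Rightarrow> 'a \<Rightarrow> complex" where
  "cut V \<mu> y = (if y \<in> V then \<mu> y else 0)"

text \<open>
  Functionals that vanish on \<open>N\<close> can be recovered from their restrictions to a complement \<open>V\<close>: compose
  with the projection \<open>p\<close> onto \<open>V\<close> along \<open>N\<close> and evaluate at the basis \<open>xs\<close>. The resulting map \<open>\<rho>\<close> from
  functions on \<open>V\<close> to coordinate vectors is linear, and it is injective on the restrictions of such
  functionals.
\<close>

theorem restricted_functionals_equivalent:
  assumes xs: "ordered_basis xs UNIV" and N: "subspace N" and V: "complement N V"
    and M: "\<And>\<mu>. \<mu> \<in># M \<Longrightarrow> functional \<mu> \<and> (\<forall>x\<in>N. \<mu> x = 0)"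
  shows "linearly_equivalent fscale (filter_mset (\<lambda>w. w \<noteq> 0) (image_mset (cut V) M))
    fscale (filter_mset (\<lambda>c. c \<noteq> 0) (image_mset (coords xs) M))"
proof -
  have "\<exists>v\<in>V. x - v \<in> N" for x
  proof -
    obtain u v where "u \<in> N" "v \<in> V" "x = u + v" using V unfolding complement_def by blast
    then show ?thesis by (intro bexI[of _ v]) simp_all
  qed
  then obtain p where p: "\<And>x. p x \<in> V" "\<And>x. x - p x \<in> N" by metis
  define \<rho> where "\<rho> w i = (if i < length xs then w (p (xs ! i)) else 0)" for w :: "'a \<Rightarrow> complex" and i
  define X where "X = {cut V \<mu> |\<mu>. functional \<mu> \<and> (\<forall>x\<in>N. \<mu> x = 0)}"
  have rho_cut: "\<rho> (cut V \<mu>) = coords xs \<mu>" if "functional \<mu>" "\<forall>x\<in>N. \<mu> x = 0" for \<mu>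
  proof -
    have "\<mu> (p x) = \<mu> x" for x
    proof -
      have "\<mu> ((x - p x) + p x) = \<mu> (x - p x) + \<mu> (p x)"
        using that(1) unfolding functional_def by blast
      then show ?thesis using that(2) p(2)[of x] by simp
    qed
    then show ?thesis by (auto simp: \<rho>_def coords_def cut_def p(1))
  qed
  have rho: "fun_linear \<rho>"
    unfolding fun_linear_iff by (auto simp: \<rho>_def fun_eq_iff fscale_def)
  interpret rho: Vector_Spaces.linear fscale fscale \<rho> by (rule rho)
  have X: "fun_space.subspace X"
  proof (rule fun_space.subspaceI)
    have "cut V (\<lambda>_. 0) = 0" by (simp add: cut_def fun_eq_iff)
    then show "0 \<in> X" unfolding X_def by (force simp: functional_def)
  next
    fix v w assume "v \<in> X" "w \<in> X"
    then obtain \<mu> \<nu> where *: "v = cut V \<mu>" "w = cut V \<nu>" "functional \<mu>" "functional \<nu>"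
      "\<forall>x\<in>N. \<mu> x = 0" "\<forall>x\<in>N. \<nu> x = 0" unfolding X_def by blast
    moreover from * have "v + w = cut V (\<lambda>x. \<mu> x + \<nu> x)" "functional (\<lambda>x. \<mu> x + \<nu> x)"
      by (auto simp: cut_def fun_eq_iff functional_def algebra_simps)
    ultimately show "v + w \<in> X" unfolding X_def by force
  next
    fix c w assume "w \<in> X"
    then obtain \<mu> where *: "w = cut V \<mu>" "functional \<mu>" "\<forall>x\<in>N. \<mu> x = 0" unfolding X_def by blast
    moreover from * have "fscale c w = cut V (\<lambda>x. c * \<mu> x)" "functional (\<lambda>x. c * \<mu> x)"
      by (auto simp: cut_def fun_eq_iff functional_def fscale_def algebra_simps)
    ultimately show "fscale c w \<in> X" unfolding X_def by force
  qed
  have kernel: "w = 0" if "w \<in> X" "\<rho> w = 0" for w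
  proof -
    obtain \<mu> where \<mu>: "w = cut V \<mu>" "functional \<mu>" "\<forall>x\<in>N. \<mu> x = 0"
      using \<open>w \<in> X\<close> unfolding X_def by blast
    then have "coords xs \<mu> = 0" using rho_cut that(2) by simp
    then show ?thesis using functional_eq_0[OF \<mu>(2) xs] \<mu>(1) by (simp add: cut_def fun_eq_iff)
  qed
  let ?E = "filter_mset (\<lambda>w. w \<noteq> 0) (image_mset (cut V) M)"
  have in_X: "w \<in> X" if "w \<in># image_mset (cut V) M" for w
    using that M unfolding X_def by auto
  have inj: "inj_on \<rho> X"
  proof (rule inj_onI)
    fix v w assume "v \<in> X" "w \<in> X" "\<rho> v = \<rho> w"
    then have "v - w = 0"
      using kernel[OF fun_space.subspace_diff[OF X]] rho.diff[of v w] by simp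
    then show "v = w" by (simp only: right_minus_eq)
  qed
  have "set_mset ?E \<subseteq> X" using in_X by auto
  then have "fun_space.span (set_mset ?E) \<subseteq> X"
    by (rule fun_space.span_minimal[OF _ X])
  then have "linearly_equivalent fscale ?E fscale (image_mset \<rho> ?E)"
    using linearly_equivalent_image[OF rho inj_on_subset[OF inj]] by blast
  moreover have "image_mset \<rho> ?E = filter_mset (\<lambda>c. c \<noteq> 0) (image_mset (coords xs) M)"
  proof -
    have "image_mset (coords xs) M = image_mset \<rho> (image_mset (cut V) M)"
      unfolding image_mset.compositionality
      by (rule image_mset_cong) (use M rho_cut in simp)
    then have "filter_mset (\<lambda>c. c \<noteq> 0) (image_mset (coords xs) M)
      = filter_mset (\<lambda>c. c \<noteq> 0) (image_mset \<rho> (image_mset (cut V) M))"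
      by (rule arg_cong)
    also have "\<dots> = image_mset \<rho> (filter_mset (\<lambda>w. \<rho> w \<noteq> 0) (image_mset (cut V) M))"
      by (simp only: filter_mset_image_mset)
    also have "filter_mset (\<lambda>w. \<rho> w \<noteq> 0) (image_mset (cut V) M) = ?E"
    proof (intro filter_mset_cong refl)
      fix w assume "w \<in># image_mset (cut V) M"
      then show "\<rho> w \<noteq> 0 \<longleftrightarrow> w \<noteq> 0" using kernel[OF in_X] rho.zero by metis
    qed
    finally show ?thesis by (rule sym)
  qed
  ultimately show ?thesis by (simp only:)
qed

text \<open>
  A flag basis of the nilradical is extended to a basis of the whole algebra, which adds only zero
  weights. The coordinate vectors of the resulting weights therefore serve two purposes: they are the
  factors of the characteristic polynomial, and the nonzero ones form a linear copy of the nonzero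
  nilradical weights.
\<close>

theorem char_polynomial_weight_coords:
  assumes "solvable" and xs: "ordered_basis xs UNIV" and V: "complement nilradical V"
  obtains C where "set_mset C \<subseteq> coord_space (length xs)" "size C = length xs"
    "char_polynomial xs = prod_mset (image_mset (linear_form (length xs)) C)"
    "linearly_equivalent fscale (nonzero_nilradical_weights V) fscale (filter_mset (\<lambda>c. c \<noteq> 0) C)"
proof -
  let ?bs = triangular_basis
  let ?m = "length ?bs"
  note bs = triangular_basis[OF assms(1)] and N = lie_ideal_nilradical[OF assms(1)]
  obtain cs where zs: "ordered_basis (?bs @ cs) UNIV"
    using extend_ordered_basis[OF bs(1)] by blast
  have "lie_ideal UNIV" by (simp add: lie_ideal_def)
  then obtain us where us: "ordered_basis us UNIV" "flag us"
    using exists_flag_basis[OF assms(1)] by blast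
  have br: "bracket x y \<in> nilradical" for x y using bracket_in_nilradical[OF us] .
  have nil: "nilpotent_ideal nilradical" using nilpotent_ideal_nilradical[OF us] .
  let ?zs = "?bs @ cs"
  have fl: "flag ?zs" using flag_append[OF bs br] .
  define C where "C = image_mset (\<lambda>a. coords xs (weight ?zs a)) (mset_set {..<length ?zs})"
  define M where "M = image_mset (weight ?bs) (mset_set {..<?m})"
  have "image_mset (coords xs) M + replicate_mset (length cs) 0 = C"
  proof -
    have "{..<length ?zs} = {..<?m} \<union> {?m..<length ?zs}" "{..<?m} \<inter> {?m..<length ?zs} = {}" by auto
    then have "mset_set {..<length ?zs} = mset_set {..<?m} + mset_set {?m..<length ?zs}"
      using mset_set_Union[of "{..<?m}" "{?m..<length ?zs}"] by simp
    then have "C = image_mset (\<lambda>a. coords xs (weight ?zs a)) (mset_set {..<?m})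
        + image_mset (\<lambda>a. coords xs (weight ?zs a)) (mset_set {?m..<length ?zs})"
      by (simp only: C_def image_mset_union)
    also have "image_mset (\<lambda>a. coords xs (weight ?zs a)) (mset_set {..<?m}) = image_mset (coords xs) M"
      unfolding M_def image_mset.compositionality
    proof (intro image_mset_cong)
      fix a assume "a \<in># mset_set {..<?m}"
      then have a: "a < ?m" by simp
      have "weight ?zs a = weight ?bs a"
        using weight_append[OF bs(1) br zs, of a] a by (simp add: fun_eq_iff)
      then show "coords xs (weight ?zs a) = (coords xs \<circ> weight ?bs) a" by simp
    qed
    also have "image_mset (\<lambda>a. coords xs (weight ?zs a)) (mset_set {?m..<length ?zs})
      = image_mset (\<lambda>_. 0) (mset_set {?m..<length ?zs})"
    proof (intro image_mset_cong)
      fix a assume "a \<in># mset_set {?m..<length ?zs}"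
      then show "coords xs (weight ?zs a) = 0"
        using weight_append[OF bs(1) br zs, of a] by (simp add: fun_eq_iff coords_def)
    qed
    also have "\<dots> = replicate_mset (length cs) 0" by (simp add: image_mset_const_eq)
    finally show ?thesis by simp
  qed
  moreover have "filter_mset (\<lambda>c. c \<noteq> 0) (replicate_mset k (0 :: nat \<Rightarrow> complex)) = {#}" for k
    by (induction k) simp_all
  ultimately have nonzero:
    "filter_mset (\<lambda>c. c \<noteq> 0) C = filter_mset (\<lambda>c. c \<noteq> 0) (image_mset (coords xs) M)"
    by (metis add.right_neutral filter_union_mset)
  have "nonzero_nilradical_weights V = filter_mset (\<lambda>w. w \<noteq> 0) (image_mset (cut V) M)"
  proof -
    have "nilradical_weights V = image_mset (cut V) M"
      unfolding nilradical_weights_def M_def image_mset.compositionality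
      by (intro image_mset_cong) (auto simp: cut_def fun_eq_iff matrix_of_ad_diagonal)
    then show ?thesis by (simp only: nonzero_nilradical_weights_def)
  qed
  moreover have "functional \<mu> \<and> (\<forall>x\<in>nilradical. \<mu> x = 0)" if "\<mu> \<in># M" for \<mu>
    using that functional_weight[OF bs(1) N] weight_nilradical[OF bs nil] unfolding M_def by auto
  ultimately have "linearly_equivalent fscale (nonzero_nilradical_weights V)
      fscale (filter_mset (\<lambda>c. c \<noteq> 0) C)"
    using restricted_functionals_equivalent[OF xs lie_ideal_subspace[OF N] V] nonzero by metis
  moreover have "char_polynomial xs = prod_mset (image_mset (linear_form (length xs)) C)"
    using char_polynomial_eq_prod[OF xs zs fl]
    by (simp add: C_def prod_unfold_prod_mset image_mset.compositionality o_def)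
  moreover have "set_mset C \<subseteq> coord_space (length xs)"
    by (auto simp: C_def coord_space_def coords_def)
  moreover have "size C = length xs"
    using length_ordered_basis[OF xs zs] by (simp add: C_def)
  ultimately show ?thesis using that by blast
qed

end

lemma filter_nonzero_image_mat_act:
  assumes B: "B \<in> carrier_mat n n" "invertible_mat B" and C: "set_mset C \<subseteq> coord_space n"
  shows "filter_mset (\<lambda>c. c \<noteq> 0) (image_mset (mat_act n B) C)
    = image_mset (mat_act n B) (filter_mset (\<lambda>c. c \<noteq> 0) C)"
proof -
  have z: "mat_act n B 0 = 0" "0 \<in> coord_space n"
    by (simp_all add: mat_act_def fun_eq_iff coord_space_def)
  have "mat_act n B c \<noteq> 0 \<longleftrightarrow> c \<noteq> 0" if "c \<in># C" for c
    using inj_onD[OF inj_on_mat_act[OF B], of c 0] z C that by auto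
  then show ?thesis
    unfolding filter_mset_image_mset by (intro arg_cong[of _ _ "image_mset _"] filter_mset_cong refl)
qed

text \<open>
  The linear algebra content of the equivalence. An invertible matrix sends zero, and only zero, to
  zero, so it carries \<open>C\<close> to \<open>C'\<close> exactly when it carries the nonzero parts to each other and the zero
  vectors are equally many. The right-hand side forces equal dimensions too: each dimension is the
  number of zero vectors plus the number of nonzero ones, and linear equivalence preserves the latter.
\<close>

theorem image_mat_act_iff:
  assumes C: "set_mset C \<subseteq> coord_space n" "size C = n"
    and C': "set_mset C' \<subseteq> coord_space n'" "size C' = n'"
  shows "n = n' \<and> (\<exists>B \<in> carrier_mat n n. invertible_mat B \<and> image_mset (mat_act n B) C = C') \<longleftrightarrow>
    count C 0 = count C' 0 \<and> linearly_equivalent fscale (filter_mset (\<lambda>c. c \<noteq> 0) C)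
      fscale (filter_mset (\<lambda>c. c \<noteq> 0) C')"
    (is "?L \<longleftrightarrow> ?R")
proof -
  let ?nz = "filter_mset (\<lambda>c::nat \<Rightarrow> complex. c \<noteq> 0)"
  have sub: "set_mset (?nz C) \<subseteq> coord_space n" "set_mset (?nz C') \<subseteq> coord_space n'"
    using C(1) C'(1) by auto
  have size: "count D 0 + size (?nz D) = size D" for D
    using arg_cong[OF mset_zero_nonzero[of D], of size] by simp
  show ?thesis
  proof
    assume ?L
    then obtain B where B: "n' = n" "B \<in> carrier_mat n n" "invertible_mat B" "image_mset (mat_act n B) C = C'"
      by blast
    have "image_mset (mat_act n B) (?nz C) = ?nz C'"
      using filter_nonzero_image_mat_act[OF B(2,3) C(1)] B(4) by simp
    then have le: "linearly_equivalent fscale (?nz C) fscale (?nz C')"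
      using linearly_equivalent_coord_iff[OF sub(1) sub(2)[unfolded B(1)]] B(2,3) by blast
    then show ?R using size[of C] size[of C'] linearly_equivalent_size[OF le] B(1) C(2) C'(2) by simp
  next
    assume ?R
    then have n: "n' = n"
      using size[of C] size[of C'] linearly_equivalent_size[of fscale "?nz C" fscale "?nz C'"] C(2) C'(2)
      by simp
    obtain B where B: "B \<in> carrier_mat n n" "invertible_mat B" "image_mset (mat_act n B) (?nz C) = ?nz C'"
      using \<open>?R\<close> linearly_equivalent_coord_iff[OF sub(1) sub(2)[unfolded n]] by blast
    have "mat_act n B 0 = 0" by (simp add: mat_act_def fun_eq_iff)
    then have "image_mset (mat_act n B) (replicate_mset (count C 0) 0 + ?nz C)
        = replicate_mset (count C' 0) 0 + ?nz C'"
      using B(3) \<open>?R\<close> by simp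
    then have "image_mset (mat_act n B) C = C'" by (simp only: mset_zero_nonzero[symmetric])
    then show ?L using n B(1,2) by blast
  qed
qed

theorem proposition3p7:
  fixes sc :: "complex \<Rightarrow> 'a \<Rightarrow> 'a::ab_group_add" and br :: "'a \<Rightarrow> 'a \<Rightarrow> 'a"
    and sc' :: "complex \<Rightarrow> 'b \<Rightarrow> 'b::ab_group_add" and br' :: "'b \<Rightarrow> 'b \<Rightarrow> 'b"
    and xs :: "'a list" and ys :: "'b list" and V :: "'a set" and V' :: "'b set"
  assumes "complex_lie_algebra sc br" and "complex_lie_algebra sc' br'"
    and "complex_lie_algebra.solvable sc br" and "complex_lie_algebra.solvable sc' br'"
    and "complex_lie_algebra.ordered_basis sc xs UNIV"
    and "complex_lie_algebra.ordered_basis sc' ys UNIV"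
    and "complex_lie_algebra.complement sc (complex_lie_algebra.nilradical sc br) V"
    and "complex_lie_algebra.complement sc' (complex_lie_algebra.nilradical sc' br') V'"
  shows "spectrally_equivalent sc br xs sc' br' ys \<longleftrightarrow>
    complex_lie_algebra.e0 sc br xs = complex_lie_algebra.e0 sc' br' ys \<and>
    linearly_equivalent
      fscale (complex_lie_algebra.nonzero_nilradical_weights sc br V)
      fscale (complex_lie_algebra.nonzero_nilradical_weights sc' br' V')"
proof -
  let ?n = "length xs" and ?n' = "length ys"
  let ?nz = "filter_mset (\<lambda>c::nat \<Rightarrow> complex. c \<noteq> 0)"
  obtain C where C: "set_mset C \<subseteq> coord_space ?n" "size C = ?n"
    and P: "complex_lie_algebra.char_polynomial sc br xs = prod_mset (image_mset (linear_form ?n) C)"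
    and W: "linearly_equivalent fscale (complex_lie_algebra.nonzero_nilradical_weights sc br V) fscale (?nz C)"
    using complex_lie_algebra.char_polynomial_weight_coords[OF assms(1,3,5,7)] by metis
  obtain C' where C': "set_mset C' \<subseteq> coord_space ?n'" "size C' = ?n'"
    and P': "complex_lie_algebra.char_polynomial sc' br' ys = prod_mset (image_mset (linear_form ?n') C')"
    and W': "linearly_equivalent fscale (complex_lie_algebra.nonzero_nilradical_weights sc' br' V') fscale (?nz C')"
    using complex_lie_algebra.char_polynomial_weight_coords[OF assms(2,4,6,8)] by metis
  have e0: "complex_lie_algebra.e0 sc br xs = count C 0" "complex_lie_algebra.e0 sc' br' ys = count C' 0"
    unfolding complex_lie_algebra.e0_def[OF assms(1)] complex_lie_algebra.e0_def[OF assms(2)] P P'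
    using Greatest_power_Var_dvd[OF C(1)] Greatest_power_Var_dvd[OF C'(1)] by blast+
  have "complex_lie_algebra.char_polynomial sc' br' ys
      = subst (row_subst B) (complex_lie_algebra.char_polynomial sc br xs)
    \<longleftrightarrow> image_mset (mat_act ?n B) C = C'" if "?n = ?n'" and B: "B \<in> carrier_mat ?n ?n" for B
  proof -
    have "subst (row_subst B) (prod_mset (image_mset (linear_form ?n) C))
        = prod_mset (image_mset (linear_form ?n) (image_mset (mat_act ?n B) C))"
      by (simp add: subst_prod_mset image_mset.compositionality o_def subst_row_subst_linear_form[OF B])
    moreover have "set_mset (image_mset (mat_act ?n B) C) \<subseteq> coord_space ?n"
      by (auto simp: mat_act_coord_space)
    ultimately show ?thesis
      unfolding P P' that(1)[symmetric]
      using prod_linear_form_inject[OF C'(1)[folded that(1)]] by metis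
  qed
  then have "spectrally_equivalent sc br xs sc' br' ys \<longleftrightarrow>
    ?n = ?n' \<and> (\<exists>B \<in> carrier_mat ?n ?n. invertible_mat B \<and> image_mset (mat_act ?n B) C = C')"
    unfolding spectrally_equivalent_def by blast
  also have "\<dots> \<longleftrightarrow> count C 0 = count C' 0 \<and> linearly_equivalent fscale (?nz C) fscale (?nz C')"
    by (rule image_mat_act_iff[OF C C'])
  also have "linearly_equivalent fscale (?nz C) fscale (?nz C') \<longleftrightarrow> linearly_equivalent
      fscale (complex_lie_algebra.nonzero_nilradical_weights sc br V)
      fscale (complex_lie_algebra.nonzero_nilradical_weights sc' br' V')"
    using linearly_equivalent_trans[OF linearly_equivalent_trans[OF W] linearly_equivalent_sym[OF W']]
      linearly_equivalent_trans[OF linearly_equivalent_trans[OF linearly_equivalent_sym[OF W]] W']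
    by (rule iffI)
  finally show ?thesis unfolding e0 .
qed

end
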